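(* Let $A$ be a rational function of degree $d\ge 2$ which is not conjugate (by a Möbius transformation) to $z^{\pm d}$ or $\pm T_d$. Then there exists an orbifold $\mathcal O_0^A$ such that $A:\mathcal O_0^A\to\mathcal O_0^A$ is a minimal holomorphic map between orbifolds, and for any orbifold $\mathcal O$ such that $A:\mathcal O\to\mathcal O$ is a minimal holomorphic map between orbifolds the relation $\mathcal O\preceq\mathcal O_0^A$ holds. Furthermore, $\mathcal O_0^{A^{\circ l}}=\mathcal O_0^A$ for any $l\geq1$ (i.e. the orbifold with the corresponding maximality property for the iterate $A^{\circ l}$ exists and is the same orbifold).
   Context: $T_d$ is the Chebyshev polynomial of degree $d$, $T_d(\cos t)=\cos(dt)$; $A^{\circ l}$ is the $l$-th iterate. An orbifold $\mathcal O$ on $\mathbb{CP}^1$ is a ramification function $\nu:\mathbb{CP}^1\to\mathbb N=\{1,2,\dots\}$ with $\nu(z)=1$ except at a finite set of points. All orbifolds are assumed to be good: it is not allowed that there is exactly one point with $\nu(z)\neq1$, nor that there are exactly two such points $z_1,z_2$ with $\nu(z_1)\neq\nu(z_2)$. The case $\nu\equiv1$ (non-ramified sphere) is allowed. A rational function $f$ is a minimal holomorphic map $f:\mathcal O_1\to\mathcal O_2$ between orbifolds with ramification functions $\nu_1,\nu_2$ if $\nu_2(f(z))=\nu_1(z)\gcd(\deg_z f,\nu_2(f(z)))$ for all $z\in\mathbb{CP}^1$, where $\deg_z f$ is the local degree of $f$ at $z$. One writes $\mathcal O_1\preceq\mathcal O_2$ if $\nu_1(z)\mid\nu_2(z)$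 for all $z\in\mathbb{CP}^1$. An orbifold with the maximality property in the claim is clearly unique, since $\preceq$ is antisymmetric; it is denoted $\mathcal O_0^A$. *)

theory Defs
  imports "HOL-Complex_Analysis.Complex_Analysis" "HOL-Computational_Algebra.Computational_Algebra"
begin

(* The Riemann sphere as the set underlying the one-point compactification of the complex plane;
   None is the point at infinity. *)
type_synonym cp1 = "complex option"

subsection \<open>Rational functions as self-maps of the sphere\<close>

(* The map [x : y] |-> [P(x, y) : Q(x, y)], where P and Q are the homogenizations of p and q
   in degree max (degree p) (degree q).  It is meaningful only for coprime p, q. *)
definition rat_map :: "complex poly \<Rightarrow> complex poly \<Rightarrow> cp1 \<Rightarrow> cp1" where
  "rat_map p q x = (case x of
     Some z \<Rightarrow> (if poly q z = 0 then None else Some (poly p z / poly q z))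
   | None \<Rightarrow> (let n = max (degree p) (degree q) in
       if coeff q n = 0 then None else Some (coeff p n / coeff q n)))"

definition rational_of_degree :: "(cp1 \<Rightarrow> cp1) \<Rightarrow> nat \<Rightarrow> bool" where
  "rational_of_degree f d \<longleftrightarrow>
     (\<exists>p q. coprime p q \<and> q \<noteq> 0 \<and> f = rat_map p q \<and> d = max (degree p) (degree q))"

definition moebius :: "complex \<Rightarrow> complex \<Rightarrow> complex \<Rightarrow> complex \<Rightarrow> cp1 \<Rightarrow> cp1" where
  "moebius a b c d = rat_map [:b, a:] [:d, c:]"

definition moebius_conjugate :: "(cp1 \<Rightarrow> cp1) \<Rightarrow> (cp1 \<Rightarrow> cp1) \<Rightarrow> bool" where
  "moebius_conjugate f g \<longleftrightarrow>
     (\<exists>a b c d. a * d - b * c \<noteq> 0 \<and>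
        f = moebius a b c d \<circ> g \<circ> inv (moebius a b c d))"

definition chebyshev_poly :: "nat \<Rightarrow> complex poly" where
  "chebyshev_poly d = (THE p. \<forall>t. poly p (cos t) = cos (of_nat d * t))"

lemma chebyshev_poly_ex1:
  "\<exists>!p :: complex poly. \<forall>t. poly p (cos t) = cos (of_nat d * t)"
proof (rule ex_ex1I)
  show "\<exists>p :: complex poly. \<forall>t. poly p (cos t) = cos (of_nat d * t)"
  proof (induction d rule: less_induct)
    case (less d)
    consider "d = 0" | "d = 1" | n where "d = Suc (Suc n)"
      by (metis One_nat_def not0_implies_Suc)
    then show ?case
    proof cases
      case 1
      then show ?thesis by (intro exI[of _ 1]) simp
    next
      case 2
      then show ?thesis by (intro exI[of _ "[:0, 1:]"]) simp
    next
      case 3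
      obtain p :: "complex poly" where p: "poly p (cos t) = cos (of_nat (Suc n) * t)" for t
        using less[of "Suc n"] 3 by auto
      obtain q :: "complex poly" where q: "poly q (cos t) = cos (of_nat n * t)" for t
        using less[of n] 3 by auto
      have "cos (of_nat d * t) = 2 * cos t * cos (of_nat (Suc n) * t) - cos (of_nat n * t)"
        for t :: complex
      proof -
        have "cos (of_nat d * t) = cos (of_nat (Suc n) * t + t)"
          by (simp add: 3 algebra_simps)
        moreover have "cos (of_nat n * t) = cos (of_nat (Suc n) * t - t)"
          by (simp add: algebra_simps)
        ultimately show ?thesis
          by (simp only: cos_add cos_diff) simp
      qed
      then have "\<forall>t. poly ([:0, 2:] * p - q) (cos t) = cos (of_nat d * t)"
        by (simp add: p q mult.commute)
      then show ?thesis by blast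
    qed
  qed
next
  fix p q :: "complex poly"
  assume "\<forall>t. poly p (cos t) = cos (of_nat d * t)" "\<forall>t. poly q (cos t) = cos (of_nat d * t)"
  then have "poly p z = poly q z" for z
    by (metis cos_Arccos)
  then show "p = q"
    using poly_eq_poly_eq_iff by blast
qed

lemma poly_chebyshev_poly: "poly (chebyshev_poly d) (cos t) = cos (of_nat d * t)"
  using theI'[OF chebyshev_poly_ex1] unfolding chebyshev_poly_def by blast

subsection \<open>Local degree\<close>

(* Affine charts centred at a point: w |-> a + w at a finite point a and w |-> 1 / w at infinity,
   together with their inverses.  The value of coord_at at the one point outside the chart is
   irrelevant, as only germs are used below. *)
fun param_at :: "cp1 \<Rightarrow> complex \<Rightarrow> cp1" where
  "param_at (Some a) w = Some (a + w)"
| "param_at None w = (if w = 0 then None else Some (1 / w))"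

fun coord_at :: "cp1 \<Rightarrow> cp1 \<Rightarrow> complex" where
  "coord_at (Some b) (Some w) = w - b"
| "coord_at (Some b) None = 0"
| "coord_at None (Some w) = 1 / w"
| "coord_at None None = 0"

(* The order of vanishing at 0 of f read in charts centred at z and at f z. *)
definition local_degree :: "(cp1 \<Rightarrow> cp1) \<Rightarrow> cp1 \<Rightarrow> nat" where
  "local_degree f z = nat (zorder (\<lambda>w. coord_at (f z) (f (param_at z w))) 0)"

subsection \<open>Orbifolds\<close>

(* A good orbifold on the sphere, given by its ramification function. *)
definition orbifold :: "(cp1 \<Rightarrow> nat) \<Rightarrow> bool" where
  "orbifold \<nu> \<longleftrightarrow>
     (\<forall>z. 1 \<le> \<nu> z) \<and> finite {z. \<nu> z \<noteq> 1} \<and>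
     \<not> (\<exists>z. {w. \<nu> w \<noteq> 1} = {z}) \<and>
     \<not> (\<exists>z1 z2. z1 \<noteq> z2 \<and> {w. \<nu> w \<noteq> 1} = {z1, z2} \<and> \<nu> z1 \<noteq> \<nu> z2)"

(* Constant maps are excluded because they have no local degree. *)
definition minimal_holomorphic_map ::
    "(cp1 \<Rightarrow> cp1) \<Rightarrow> (cp1 \<Rightarrow> nat) \<Rightarrow> (cp1 \<Rightarrow> nat) \<Rightarrow> bool" where
  "minimal_holomorphic_map f \<nu>1 \<nu>2 \<longleftrightarrow>
     (\<exists>d\<ge>1. rational_of_degree f d) \<and> orbifold \<nu>1 \<and> orbifold \<nu>2 \<and>
     (\<forall>z. \<nu>2 (f z) = \<nu>1 z * gcd (local_degree f z) (\<nu>2 (f z)))"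

definition orbifold_le :: "(cp1 \<Rightarrow> nat) \<Rightarrow> (cp1 \<Rightarrow> nat) \<Rightarrow> bool"  (infix "\<preceq>" 50) where
  "\<nu>1 \<preceq> \<nu>2 \<longleftrightarrow> (\<forall>z. \<nu>1 z dvd \<nu>2 z)"

definition is_maximal_orbifold :: "(cp1 \<Rightarrow> cp1) \<Rightarrow> (cp1 \<Rightarrow> nat) \<Rightarrow> bool" where
  "is_maximal_orbifold f \<nu>0 \<longleftrightarrow>
     orbifold \<nu>0 \<and> minimal_holomorphic_map f \<nu>0 \<nu>0 \<and>
     (\<forall>\<nu>. orbifold \<nu> \<and> minimal_holomorphic_map f \<nu> \<nu> \<longrightarrow> \<nu> \<preceq> \<nu>0)"

lemma is_maximal_orbifold_unique:
  "is_maximal_orbifold f \<nu> \<Longrightarrow> is_maximal_orbifold f \<nu>' \<Longrightarrow> \<nu> = \<nu>'"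
  unfolding is_maximal_orbifold_def orbifold_le_def by (meson dvd_antisym ext)

end

theory Submission
  imports Defs
begin

text \<open>
Minimality of $A : \mathcal O \to \mathcal O$ determines the ramification at $z$ from the one at
$A(z)$: it is $\nu(z) = \nu(A(z)) / \gcd(\deg_z A, \nu(A(z)))$. So the orbifolds in question are the
fixed points of an operator \<open>pullback A\<close>. On $p$-adic valuations this operator is the monotone map
$v \mapsto \max(0, v - v_p(\deg_z A))$, and therefore it commutes with least common multiples
(\<open>pullback_orbifold_lcm\<close>); being contravariantly functorial, it turns the $l$-th iterate of $A$ into
its own $l$-th iterate (\<open>pullback_funpow\<close>). Least common multiples of invariant orbifolds are again
invariant and good (\<open>orbifold_lcm_good\<close>), so a maximal one exists as soon as the invariant orbifolds
are bounded.

Boundedness comes from the Riemann-Hurwitz inequality (\<open>riemann_hurwitz_le\<close>), which forces the Euler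
characteristic of an invariant orbifold to be nonnegative (\<open>invariant_ramification_sum_le\<close>). Thus the
support has at most four points, and a very large value can occur only in the signatures $(N, N)$ and
$(2, 2, N)$. If $N$ exceeds twice the degree, the set of points of ramification $N$ is completely
invariant.
In the first case $A$ is conjugate to a power map. In the second case $A$ is conjugate to a polynomial
$P$ for which $P^2 - 1$ is $x^2 - 1$ times a square, and the Pell equation identifies $P$ with a
Chebyshev polynomial up to sign (\<open>pell_solutions\<close>).

For the iterates, let $\nu$ be invariant under $A^{\circ l}$. The operator \<open>pullback A\<close> permutes
cyclically the first $l$ pullbacks of $\nu$, so their least common multiple is invariant under $A$ and
lies above $\nu$ (\<open>periodic_le_invariant_orbifold\<close>). It follows that the maximal orbifold of $A$ is
also maximal for $A^{\circ l}$.

Local degrees are handled by a normal form $w^m g(w)$ in the standard charts, which composes well;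
for a rational map $p/q$ the exponent is the order of vanishing of $p - bq$, or of $q$ at a pole.
\<close>

section \<open>Pulling back ramification functions\<close>

text \<open>The quotient $a / \gcd(m, a)$ is known by its multiples. Computing with multiples instead of
quotients turns composition and least common multiples of pullbacks into pure logic.\<close>

lemma div_gcd_dvd_iff:
  fixes a m y :: nat
  assumes "a > 0"
  shows "a div gcd m a dvd y \<longleftrightarrow> a dvd m * y"
proof -
  define g where "g = gcd m a"
  have "g > 0"
    using assms by (simp add: g_def)
  obtain m' a' where ma: "m = m' * g" "a = a' * g" and "coprime m' a'"
    using gcd_coprime_exists[of m a] assms unfolding g_def by auto
  have "a dvd m * y \<longleftrightarrow> a' dvd m' * y"
    using \<open>g > 0\<close> unfolding ma by (simp add: mult.commute mult.left_commute)
  also have "\<dots> \<longleftrightarrow> a' dvd y"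
    using \<open>coprime m' a'\<close> by (simp add: coprime_dvd_mult_right_iff coprime_commute)
  also have "a' = a div gcd m a"
  proof -
    have "a div g = a'"
      using ma(2) \<open>g > 0\<close> by auto
    then show ?thesis
      unfolding g_def ..
  qed
  finally show ?thesis ..
qed

lemma eq_if_same_multiples:
  fixes a b :: nat
  assumes "\<And>y. a dvd y \<longleftrightarrow> b dvd y"
  shows "a = b"
  using assms[of a] assms[of b] by (simp add: dvd_antisym)

text \<open>The unique ramification function on the source that makes $f$ minimal for the given one on the
target. On $p$-adic valuations it is $v \mapsto \max(0, v - v_p(\deg_z f))$, a monotone map; this is
why it commutes with least common multiples.\<close>

definition pullback :: "(cp1 \<Rightarrow> cp1) \<Rightarrow> (cp1 \<Rightarrow> nat) \<Rightarrow> cp1 \<Rightarrow> nat" where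
  "pullback f \<nu> z = \<nu> (f z) div gcd (local_degree f z) (\<nu> (f z))"

lemma pullback_dvd_iff:
  assumes "\<And>z. 0 < \<nu> z"
  shows "pullback f \<nu> z dvd y \<longleftrightarrow> \<nu> (f z) dvd local_degree f z * y"
  unfolding pullback_def using div_gcd_dvd_iff[of "\<nu> (f z)" "local_degree f z" y] assms[of "f z"]
  by simp

lemma pullback_dvd: "pullback f \<nu> z dvd \<nu> (f z)"
  unfolding pullback_def using dvd_div_mult_self[OF gcd_dvd2] dvd_triv_left by metis

lemma pullback_pos:
  assumes "\<And>z. 0 < \<nu> z"
  shows "0 < pullback f \<nu> z"
  using assms[of "f z"] unfolding pullback_def by (simp add: div_greater_zero_iff)

lemma minimal_holomorphic_map_iff_pullback:
  "minimal_holomorphic_map f \<nu>1 \<nu>2 \<longleftrightarrow>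
     (\<exists>d\<ge>1. rational_of_degree f d) \<and> orbifold \<nu>1 \<and> orbifold \<nu>2 \<and> pullback f \<nu>2 = \<nu>1"
proof -
  have "\<nu>2 (f z) = \<nu>1 z * gcd (local_degree f z) (\<nu>2 (f z)) \<longleftrightarrow> pullback f \<nu>2 z = \<nu>1 z"
    if "orbifold \<nu>2" for z
  proof -
    have "\<nu>2 (f z) > 0"
      using that unfolding orbifold_def by (metis less_le_trans zero_less_one)
    then have "gcd (local_degree f z) (\<nu>2 (f z)) > 0"
      by simp
    then show ?thesis
      unfolding pullback_def
      using dvd_div_eq_mult[OF _ gcd_dvd2, of "local_degree f z" "\<nu>2 (f z)" "\<nu>1 z"] by auto
  qed
  then have "(\<forall>z. \<nu>2 (f z) = \<nu>1 z * gcd (local_degree f z) (\<nu>2 (f z))) \<longleftrightarrow> pullback f \<nu>2 = \<nu>1"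
    if "orbifold \<nu>2"
    using that by (simp add: fun_eq_iff)
  then show ?thesis
    unfolding minimal_holomorphic_map_def by blast
qed

text \<open>Multiplicativity of the local degree makes the pullback contravariantly functorial.\<close>

lemma pullback_comp:
  assumes "\<And>z. 0 < \<nu> z"
    and "\<And>z. local_degree (f \<circ> g) z = local_degree f (g z) * local_degree g z"
  shows "pullback (f \<circ> g) \<nu> = pullback g (pullback f \<nu>)"
proof
  fix z
  show "pullback (f \<circ> g) \<nu> z = pullback g (pullback f \<nu>) z"
    by (rule eq_if_same_multiples)
      (simp add: pullback_dvd_iff pullback_pos assms(1) assms(2)[of z] mult.assoc)
qed

section \<open>Least common multiples of orbifolds\<close>

definition orbifold_lcm :: "(cp1 \<Rightarrow> nat) set \<Rightarrow> cp1 \<Rightarrow> nat" where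
  "orbifold_lcm N z = (LCM \<nu>\<in>N. \<nu> z)"

lemma orbifold_lcm_dvd_iff: "orbifold_lcm N z dvd y \<longleftrightarrow> (\<forall>\<nu>\<in>N. \<nu> z dvd y)"
  unfolding orbifold_lcm_def Lcm_dvd_iff by blast

lemma orbifold_le_lcm: "\<nu> \<in> N \<Longrightarrow> \<nu> \<preceq> orbifold_lcm N"
  unfolding orbifold_lcm_def orbifold_le_def by (intro allI dvd_Lcm imageI)

lemma orbifold_lcm_pos:
  assumes "finite N" "\<And>\<nu> z. \<nu> \<in> N \<Longrightarrow> 0 < \<nu> z"
  shows "0 < orbifold_lcm N z"
proof -
  have "0 \<notin> (\<lambda>\<nu>. \<nu> z) ` N"
  proof
    assume "0 \<in> (\<lambda>\<nu>. \<nu> z) ` N"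
    then obtain \<nu> where "\<nu> \<in> N" "\<nu> z = 0"
      by force
    then show False
      using assms(2)[of \<nu> z] by simp
  qed
  then have "Lcm ((\<lambda>\<nu>. \<nu> z) ` N) \<noteq> 0"
    using Lcm_0_iff[OF finite_imageI[OF assms(1)]] by blast
  then show ?thesis
    unfolding orbifold_lcm_def by simp
qed

text \<open>A number is a multiple of both sides exactly when \<open>local_degree f z * y\<close> is a multiple of every
\<open>\<nu> (f z)\<close>.\<close>

lemma pullback_orbifold_lcm:
  assumes "finite N" "\<And>\<nu> z. \<nu> \<in> N \<Longrightarrow> 0 < \<nu> z"
  shows "pullback f (orbifold_lcm N) = orbifold_lcm (pullback f ` N)"
proof
  fix z
  show "pullback f (orbifold_lcm N) z = orbifold_lcm (pullback f ` N) z"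
    by (rule eq_if_same_multiples)
      (simp add: pullback_dvd_iff orbifold_lcm_pos assms orbifold_lcm_dvd_iff)
qed

text \<open>A least common multiple of ramification functions may have the forbidden supports (one point, or
two points with unequal values), so a domination hypothesis is needed: every value of a member
divides some value of a member that is itself good. On a support of at most two points a good
orbifold is constant, hence its values divide the least common multiple at either point.
The hypothesis holds in both applications: for two good orbifolds, and for the iterated pullbacks of
one good orbifold.\<close>

lemma orbifold_lcm_good:
  assumes "finite N"
    and pos: "\<And>\<nu> z. \<nu> \<in> N \<Longrightarrow> 0 < \<nu> z"
    and fin: "\<And>\<nu>. \<nu> \<in> N \<Longrightarrow> finite {z. \<nu> z \<noteq> 1}"
    and dom: "\<And>\<nu>. \<nu> \<in> N \<Longrightarrow> \<exists>\<mu>\<in>N. orbifold \<mu> \<and> (\<forall>z. \<exists>w. \<nu> z dvd \<mu> w)"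
  shows "orbifold (orbifold_lcm N)"
proof -
  define L where "L = orbifold_lcm N"
  have supp_le: "\<mu> w = 1" if "\<mu> \<in> N" "L w = 1" for \<mu> w
  proof -
    have "\<mu> w dvd L w"
      using orbifold_le_lcm[OF that(1)] unfolding L_def orbifold_le_def by blast
    then show ?thesis
      using that(2) by simp
  qed
  have finL: "finite {z. L z \<noteq> 1}"
  proof (rule finite_subset)
    show "{z. L z \<noteq> 1} \<subseteq> (\<Union>\<nu>\<in>N. {z. \<nu> z \<noteq> 1})"
    proof
      fix z assume "z \<in> {z. L z \<noteq> 1}"
      then have "\<not> L z dvd 1" by simp
      then show "z \<in> (\<Union>\<nu>\<in>N. {z. \<nu> z \<noteq> 1})"
        unfolding L_def orbifold_lcm_dvd_iff by auto
    qed
  qed (use assms(1) fin in auto)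
  have single: False if "{w. L w \<noteq> 1} = {c}" for c
  proof -
    have "\<nu> c dvd 1" if N: "\<nu> \<in> N" for \<nu>
    proof -
      obtain \<mu> w where \<mu>: "\<mu> \<in> N" "orbifold \<mu>" "\<nu> c dvd \<mu> w"
        using dom[OF N] by blast
      have "{w. \<mu> w \<noteq> 1} \<subseteq> {c}"
        using supp_le[OF \<mu>(1)] \<open>{w. L w \<noteq> 1} = {c}\<close> by blast
      then have "{w. \<mu> w \<noteq> 1} = {}"
        using \<mu>(2) unfolding orbifold_def subset_singleton_iff by blast
      then show ?thesis
        using \<mu>(3) by auto
    qed
    then have "L c dvd 1"
      unfolding L_def orbifold_lcm_dvd_iff by blast
    then show False
      using that by auto
  qed
  have pair: "L a dvd L b" if ab: "{w. L w \<noteq> 1} = {a, b}" for a b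
    unfolding L_def orbifold_lcm_dvd_iff
  proof
    fix \<nu> assume "\<nu> \<in> N"
    then obtain \<mu> w where \<mu>: "\<mu> \<in> N" "orbifold \<mu>" "\<nu> a dvd \<mu> w"
      using dom by blast
    have sub: "{w. \<mu> w \<noteq> 1} \<subseteq> {a, b}"
      using supp_le[OF \<mu>(1)] ab by blast
    have "\<mu> a = \<mu> b"
    proof (cases "a = b")
      case False
      have "{w. \<mu> w \<noteq> 1} \<noteq> {a}" "{w. \<mu> w \<noteq> 1} \<noteq> {b}"
        using \<mu>(2) unfolding orbifold_def by blast+
      then consider "{w. \<mu> w \<noteq> 1} = {}" | "{w. \<mu> w \<noteq> 1} = {a, b}"
        using sub by blast
      then show ?thesis
      proof cases
        case 1
        then show ?thesis by auto
      next
        case 2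
        then show ?thesis using \<mu>(2) False unfolding orbifold_def by blast
      qed
    qed simp
    then have "\<mu> w dvd \<mu> b"
    proof (cases "w \<in> {a, b}")
      case False
      then have "\<mu> w = 1"
        using sub by blast
      then show ?thesis
        by simp
    qed auto
    then have "\<mu> w dvd L b"
      using orbifold_le_lcm[OF \<mu>(1)] unfolding orbifold_le_def L_def[symmetric]
      by (blast intro: dvd_trans)
    then show "\<nu> a dvd orbifold_lcm N b"
      using \<mu>(3) unfolding L_def[symmetric] by (blast intro: dvd_trans)
  qed
  have "L a = L b" if "{w. L w \<noteq> 1} = {a, b}" for a b
    using pair[OF that] pair[of b a] that by (simp add: insert_commute dvd_antisym)
  moreover have "1 \<le> L z" for z
    using orbifold_lcm_pos[OF assms(1), of z] pos by (simp add: L_def Suc_le_eq)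
  ultimately show ?thesis
    using finL single unfolding orbifold_def L_def[symmetric] by blast
qed

text \<open>Pulling back permutes a cycle of ramification functions, hence fixes the least common multiple of
the cycle.\<close>

lemma orbit_lcm_invariant:
  assumes pos: "\<And>z. 0 < \<nu> z" and "l \<ge> 1" and per: "(pullback f ^^ l) \<nu> = \<nu>"
  shows "pullback f (orbifold_lcm ((\<lambda>i. (pullback f ^^ i) \<nu>) ` {..<l})) =
           orbifold_lcm ((\<lambda>i. (pullback f ^^ i) \<nu>) ` {..<l})"
proof -
  define N where "N = (\<lambda>i. (pullback f ^^ i) \<nu>) ` {..<l}"
  have N1: "0 < (pullback f ^^ i) \<nu> z" for i z
    by (induction i arbitrary: z) (simp_all add: pos pullback_pos)
  have "pullback f ` N = (\<lambda>i. (pullback f ^^ i) \<nu>) ` Suc ` {..<l}"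
    unfolding N_def image_image by simp
  also have "Suc ` {..<l} = insert l ({..<l} - {0})"
  proof (intro equalityI subsetI)
    fix x assume "x \<in> insert l ({..<l} - {0})"
    then have "0 < x" "x \<le> l"
      using \<open>l \<ge> 1\<close> by auto
    then show "x \<in> Suc ` {..<l}"
      by (intro image_eqI[of _ _ "x - 1"]) auto
  qed auto
  also have "(\<lambda>i. (pullback f ^^ i) \<nu>) ` \<dots> = (\<lambda>i. (pullback f ^^ i) \<nu>) ` insert 0 ({..<l} - {0})"
    by (simp only: image_insert per funpow.simps(1) id_apply)
  also have "insert 0 ({..<l} - {0}) = {..<l}"
    using \<open>l \<ge> 1\<close> by auto
  finally have "pullback f ` N = N"
    unfolding N_def .
  moreover have "pullback f (orbifold_lcm N) = orbifold_lcm (pullback f ` N)"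
    by (rule pullback_orbifold_lcm) (auto simp: N_def N1)
  ultimately show ?thesis
    unfolding N_def by simp
qed

section \<open>Rational maps in homogeneous coordinates\<close>

text \<open>Over the complex numbers coprimality is the absence of common roots, which is easy to track under
substitution.\<close>

lemma coprime_complex_poly_iff:
  fixes p q :: "complex poly"
  shows "coprime p q \<longleftrightarrow> (\<forall>z. poly p z \<noteq> 0 \<or> poly q z \<noteq> 0)"
proof
  assume "\<forall>z. poly p z \<noteq> 0 \<or> poly q z \<noteq> 0"
  show "coprime p q"
  proof (rule coprimeI)
    fix c assume "c dvd p" "c dvd q"
    then have "poly c z \<noteq> 0" for z
      using \<open>\<forall>z. poly p z \<noteq> 0 \<or> poly q z \<noteq> 0\<close> by (metis dvdE mult_eq_0_iff poly_mult)
    then show "is_unit c"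
      using alg_closed_imp_poly_has_root[of c] by (metis is_unit_iff_degree poly_0 neq0_conv)
  qed
qed (metis coprime_poly_0)

text \<open>The point $[u : v]$ of the projective line. Homogeneous coordinates spare the case distinction
between finite points and infinity.\<close>

definition pt :: "complex \<Rightarrow> complex \<Rightarrow> cp1" where
  "pt u v = (if v = 0 then None else Some (u / v))"

lemma pt_eq_iff:
  assumes "u \<noteq> 0 \<or> v \<noteq> 0" "u' \<noteq> 0 \<or> v' \<noteq> 0"
  shows "pt u v = pt u' v' \<longleftrightarrow> u * v' = u' * v"
  using assms by (auto simp: pt_def field_simps)

lemma pt_exhaust:
  obtains u v where "u \<noteq> 0 \<or> v \<noteq> 0" "x = pt u v"
proof (cases x)
  case None
  then show ?thesis using that[of 1 0] by (simp add: pt_def)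
next
  case (Some a)
  then show ?thesis using that[of a 1] by (simp add: pt_def)
qed

text \<open>The homogenization of \<open>p\<close> in degree \<open>n\<close>, evaluated at $(u, v)$.\<close>

definition hom_eval :: "nat \<Rightarrow> complex poly \<Rightarrow> complex \<Rightarrow> complex \<Rightarrow> complex" where
  "hom_eval n p u v = (\<Sum>i\<le>n. coeff p i * u ^ i * v ^ (n - i))"

lemma hom_eval_affine:
  assumes "v \<noteq> 0" "degree p \<le> n"
  shows "hom_eval n p u v = v ^ n * poly p (u / v)"
proof -
  have "poly p (u / v) = (\<Sum>i\<le>n. coeff p i * (u / v) ^ i)"
    unfolding poly_altdef using assms(2)
    by (intro sum.mono_neutral_left) (auto simp: coeff_eq_0)
  then have "v ^ n * poly p (u / v) = (\<Sum>i\<le>n. coeff p i * u ^ i * (v ^ n / v ^ i))"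
    by (simp add: sum_distrib_left power_divide mult_ac)
  also have "\<dots> = hom_eval n p u v"
    unfolding hom_eval_def using assms(1) by (intro sum.cong) (auto simp: power_diff)
  finally show ?thesis ..
qed

lemma hom_eval_infinity: "hom_eval n p u 0 = coeff p n * u ^ n"
proof -
  have "hom_eval n p u 0 = (\<Sum>i\<in>{n}. coeff p i * u ^ i * 0 ^ (n - i))"
    unfolding hom_eval_def by (intro sum.mono_neutral_right) auto
  then show ?thesis by simp
qed

lemma rat_map_Some: "rat_map p q (Some z) = pt (poly p z) (poly q z)"
  by (simp add: rat_map_def pt_def)

lemma rat_map_None:
  "rat_map p q None = pt (coeff p (max (degree p) (degree q))) (coeff q (max (degree p) (degree q)))"
  by (simp add: rat_map_def pt_def Let_def)

lemma rat_map_pt: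
  assumes "u \<noteq> 0 \<or> v \<noteq> 0" and n: "n = max (degree p) (degree q)"
  shows "rat_map p q (pt u v) = pt (hom_eval n p u v) (hom_eval n q u v)"
proof (cases "v = 0")
  case True
  then have "pt u v = None" "u \<noteq> 0"
    using assms by (auto simp: pt_def)
  then show ?thesis
    using True by (auto simp: rat_map_None n hom_eval_infinity pt_def)
next
  case False
  then have "pt u v = Some (u / v)"
    by (simp add: pt_def)
  then show ?thesis
    using False by (auto simp: rat_map_Some n hom_eval_affine pt_def)
qed

lemma coprime_top_coeff:
  fixes p q :: "complex poly"
  assumes "coprime p q" "n = max (degree p) (degree q)"
  shows "coeff p n \<noteq> 0 \<or> coeff q n \<noteq> 0"
proof (rule ccontr)
  assume *: "\<not> ?thesis"
  have "p = 0 \<and> q = 0"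
  proof (cases "degree p \<ge> degree q")
    case True
    then have "p = 0" using * assms(2) by (simp add: max_def)
    then show ?thesis using True * assms(2) by (auto elim!: degree_eq_zeroE)
  next
    case False
    then have "q = 0" using * assms(2) by (simp add: max_def)
    then show ?thesis using False by simp
  qed
  then show False
    using assms(1) by simp
qed

lemma hom_eval_coprime:
  assumes "coprime p q" and n: "n = max (degree p) (degree q)" and "u \<noteq> 0 \<or> v \<noteq> 0"
  shows "hom_eval n p u v \<noteq> 0 \<or> hom_eval n q u v \<noteq> 0"
proof (cases "v = 0")
  case True
  then show ?thesis
    using coprime_top_coeff[OF assms(1,2)] assms(3) by (auto simp: hom_eval_infinity)
next
  case False
  then show ?thesis
    using coprime_poly_0[OF assms(1), of "u / v"] by (auto simp: hom_eval_affine n)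
qed

lemma coeff_mult_top:
  fixes p q :: "'a::comm_semiring_1 poly"
  assumes "degree p \<le> m" "degree q \<le> n"
  shows "coeff (p * q) (m + n) = coeff p m * coeff q n"
proof -
  have "coeff p i * coeff q (m + n - i) = 0" if "i \<le> m + n" "i \<noteq> m" for i
    using that assms by (cases "i < m") (auto simp: coeff_eq_0)
  then have "(\<Sum>i\<le>m + n. coeff p i * coeff q (m + n - i)) = (\<Sum>i\<in>{m}. coeff p i * coeff q (m + n - i))"
    by (intro sum.mono_neutral_right) auto
  then show ?thesis
    by (simp add: coeff_mult)
qed

lemma degree_power_le_mult:
  fixes p :: "'a::comm_semiring_1 poly"
  assumes "degree p \<le> e"
  shows "degree (p ^ i) \<le> i * e"
  using degree_power_le[of p i] assms by (metis le_trans mult.commute mult_le_mono1)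

lemma coeff_power_top:
  fixes p :: "'a::comm_semiring_1 poly"
  assumes "degree p \<le> e"
  shows "coeff (p ^ i) (i * e) = coeff p e ^ i"
proof (induction i)
  case (Suc i)
  then show ?case
    using coeff_mult_top[OF assms degree_power_le_mult[OF assms]] by simp
qed simp

text \<open>The homogenization of \<open>p\<close> in degree \<open>n\<close> with polynomials substituted for its variables. With
$r = 1$ and $s = x$ it reverses the coefficients of \<open>p\<close>, which is the change of chart to infinity.\<close>

definition hom_comp :: "nat \<Rightarrow> complex poly \<Rightarrow> complex poly \<Rightarrow> complex poly \<Rightarrow> complex poly" where
  "hom_comp n p r s = (\<Sum>i\<le>n. smult (coeff p i) (r ^ i * s ^ (n - i)))"

lemma poly_hom_comp: "poly (hom_comp n p r s) z = hom_eval n p (poly r z) (poly s z)"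
  by (simp add: hom_comp_def hom_eval_def poly_sum mult.assoc)

lemma degree_hom_comp_le:
  assumes "degree r \<le> e" "degree s \<le> e"
  shows "degree (hom_comp n p r s) \<le> n * e"
  unfolding hom_comp_def
proof (intro degree_sum_le)
  fix i assume "i \<in> {..n}"
  then have "i * e + (n - i) * e = n * e"
    by (simp add: algebra_simps flip: distrib_right)
  then show "degree (smult (coeff p i) (r ^ i * s ^ (n - i))) \<le> n * e"
    using degree_power_le_mult[OF assms(1), of i] degree_power_le_mult[OF assms(2), of "n - i"]
      degree_mult_le[of "r ^ i" "s ^ (n - i)"] degree_smult_le[of "coeff p i" "r ^ i * s ^ (n - i)"]
    by linarith
qed simp

lemma coeff_hom_comp_top:
  assumes "degree r \<le> e" "degree s \<le> e"
  shows "coeff (hom_comp n p r s) (n * e) = hom_eval n p (coeff r e) (coeff s e)"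
proof -
  have "coeff (r ^ i * s ^ (n - i)) (n * e) = coeff r e ^ i * coeff s e ^ (n - i)" if "i \<le> n" for i
  proof -
    have "i * e + (n - i) * e = n * e"
      using that by (simp flip: distrib_right)
    then show ?thesis
      using coeff_mult_top[OF degree_power_le_mult[OF assms(1), of i] degree_power_le_mult[OF assms(2), of "n - i"]]
      by (simp add: coeff_power_top assms)
  qed
  then show ?thesis
    unfolding hom_comp_def hom_eval_def by (auto simp: coeff_sum mult.assoc intro!: sum.cong)
qed

text \<open>The two homogenized composites have no common zero on the sphere: none at a finite point, so they
are coprime, and none at infinity, so their top coefficients do not both vanish and the degree is
exactly the product.\<close>

lemma rational_of_degree_comp:
  assumes "rational_of_degree f m" "rational_of_degree g e" "m \<ge> 1" "e \<ge> 1"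
  shows "rational_of_degree (f \<circ> g) (m * e)"
proof -
  obtain p q where pq: "coprime p q" "f = rat_map p q" and m: "m = max (degree p) (degree q)"
    using assms(1) unfolding rational_of_degree_def by blast
  obtain r s where rs: "coprime r s" "g = rat_map r s" and e: "e = max (degree r) (degree s)"
    using assms(2) unfolding rational_of_degree_def by blast
  define P where "P = hom_comp m p r s"
  define Q where "Q = hom_comp m q r s"
  have rse: "degree r \<le> e" "degree s \<le> e"
    using e by auto
  have "coprime P Q"
    unfolding coprime_complex_poly_iff P_def Q_def poly_hom_comp
    using hom_eval_coprime[OF pq(1) m] coprime_poly_0[OF rs(1)] by blast
  have le: "degree P \<le> m * e" "degree Q \<le> m * e"
    unfolding P_def Q_def by (simp_all add: degree_hom_comp_le rse)
  have top: "coeff P (m * e) = hom_eval m p (coeff r e) (coeff s e)"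
       "coeff Q (m * e) = hom_eval m q (coeff r e) (coeff s e)"
    unfolding P_def Q_def by (simp_all add: coeff_hom_comp_top rse)
  have rs_top: "coeff r e \<noteq> 0 \<or> coeff s e \<noteq> 0"
    by (rule coprime_top_coeff[OF rs(1) e])
  have "coeff P (m * e) \<noteq> 0 \<or> coeff Q (m * e) \<noteq> 0"
    unfolding top by (rule hom_eval_coprime[OF pq(1) m rs_top])
  then have deg: "m * e = max (degree P) (degree Q)"
    using le le_degree by (metis le_antisym max.bounded_iff max.cobounded1 max.cobounded2 order_trans)
  have "(f \<circ> g) x = rat_map P Q x" for x
  proof (cases x)
    case None
    then show ?thesis
      using rat_map_pt[OF rs_top m] by (simp add: pq rs rat_map_None top flip: e deg)
  next
    case (Some z)
    have "poly r z \<noteq> 0 \<or> poly s z \<noteq> 0"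
      by (rule coprime_poly_0[OF rs(1)])
    then show ?thesis
      using Some rat_map_pt[OF _ m] by (simp add: pq rs rat_map_Some P_def Q_def poly_hom_comp)
  qed
  then have "f \<circ> g = rat_map P Q" ..
  moreover have "Q \<noteq> 0"
  proof
    assume "Q = 0"
    then have "is_unit P"
      using \<open>coprime P Q\<close> by simp
    then have "degree P = 0"
      using is_unit_iff_degree[of P] by (cases "P = 0") auto
    then show False
      using deg \<open>Q = 0\<close> assms(3,4) by simp
  qed
  ultimately show ?thesis
    unfolding rational_of_degree_def using \<open>coprime P Q\<close> deg by blast
qed

section \<open>Moebius transformations\<close>

lemma moebius_pt:
  assumes "a * d - b * c \<noteq> 0" "u \<noteq> 0 \<or> v \<noteq> 0"
  shows "moebius a b c d (pt u v) = pt (a * u + b * v) (c * u + d * v)"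
proof -
  have "max (degree [:b, a:]) (degree [:d, c:]) = 1"
    using assms(1) by auto
  then show ?thesis
    unfolding moebius_def using rat_map_pt[OF assms(2), of 1 "[:b, a:]" "[:d, c:]"]
    by (simp add: hom_eval_def add.commute)
qed

lemma moebius_pt_nonzero:
  assumes "a * d - b * c \<noteq> 0" "u \<noteq> 0 \<or> v \<noteq> 0"
  shows "a * u + b * v \<noteq> 0 \<or> c * u + d * v \<noteq> (0 :: complex)"
proof (rule ccontr)
  assume "\<not> ?thesis"
  then have z: "a * u + b * v = 0" "c * u + d * v = 0"
    by auto
  have "(a * d - b * c) * u = d * (a * u + b * v) - b * (c * u + d * v)"
       "(a * d - b * c) * v = a * (c * u + d * v) - c * (a * u + b * v)"
    by (simp_all add: algebra_simps)
  then show False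
    using assms unfolding z by simp
qed

lemma rational_of_degree_moebius:
  assumes "a * d - b * c \<noteq> 0"
  shows "rational_of_degree (moebius a b c d) 1"
proof -
  have "coprime [:b, a:] [:d, c:]"
    using moebius_pt_nonzero[OF assms, of _ 1] by (simp add: coprime_complex_poly_iff add.commute mult.commute)
  moreover have "[:d, c:] \<noteq> 0" "1 = max (degree [:b, a:]) (degree [:d, c:])"
    using assms by auto
  ultimately show ?thesis
    unfolding rational_of_degree_def moebius_def by blast
qed

lemma moebius_det_comp:
  fixes a b c d :: complex
  assumes "a * d - b * c \<noteq> 0" "a' * d' - b' * c' \<noteq> 0"
  shows "(a * a' + b * c') * (c * b' + d * d') - (a * b' + b * d') * (c * a' + d * c') \<noteq> 0"
proof -
  have "(a * a' + b * c') * (c * b' + d * d') - (a * b' + b * d') * (c * a' + d * c') =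
          (a * d - b * c) * (a' * d' - b' * c')"
    by (simp add: algebra_simps)
  then show ?thesis
    using assms by simp
qed

lemma moebius_comp:
  assumes "a * d - b * c \<noteq> 0" "a' * d' - b' * c' \<noteq> 0"
  shows "moebius a b c d \<circ> moebius a' b' c' d' =
           moebius (a * a' + b * c') (a * b' + b * d') (c * a' + d * c') (c * b' + d * d')"
proof
  fix x
  obtain u v where uv: "u \<noteq> 0 \<or> v \<noteq> 0" "x = pt u v"
    by (rule pt_exhaust)
  show "(moebius a b c d \<circ> moebius a' b' c' d') x =
      moebius (a * a' + b * c') (a * b' + b * d') (c * a' + d * c') (c * b' + d * d') x"
    using uv moebius_pt_nonzero[OF assms(2) uv(1)] assms moebius_det_comp[OF assms]
    by (simp add: moebius_pt) (simp add: algebra_simps)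
qed

lemma moebius_scalar:
  assumes "k \<noteq> 0"
  shows "moebius k 0 0 k = id"
proof
  fix x
  obtain u v where uv: "u \<noteq> 0 \<or> v \<noteq> 0" "x = pt u v"
    by (rule pt_exhaust)
  show "moebius k 0 0 k x = id x"
    using uv assms moebius_pt[of k k 0 0 u v] by (simp add: pt_def)
qed

lemma moebius_inverse:
  assumes "a * d - b * c \<noteq> 0"
  shows "moebius a b c d \<circ> moebius d (- b) (- c) a = id"
    and "moebius d (- b) (- c) a \<circ> moebius a b c d = id"
proof -
  have "d * a - (- b) * (- c) \<noteq> 0"
    using assms by (simp add: mult.commute)
  then show "moebius a b c d \<circ> moebius d (- b) (- c) a = id"
    and "moebius d (- b) (- c) a \<circ> moebius a b c d = id"
    using moebius_scalar[OF assms] assms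
    by (subst moebius_comp; simp add: mult.commute)+
qed

lemma inv_moebius:
  assumes "a * d - b * c \<noteq> 0"
  shows "inv (moebius a b c d) = moebius d (- b) (- c) a"
  using moebius_inverse[OF assms] by (intro inv_unique_comp)

section \<open>Local normal forms\<close>

text \<open>In the standard charts $f$ is $w \mapsto w^m g(w)$ with a unit $g$. Unlike the order of vanishing
that defines the local degree, this form composes: substituting one normal form into another gives
a normal form. The factor $g$ and the equation are also required at $w = 0$, which forces
$m \ge 1$.\<close>

definition local_form :: "(cp1 \<Rightarrow> cp1) \<Rightarrow> cp1 \<Rightarrow> nat \<Rightarrow> bool" where
  "local_form f z m \<longleftrightarrow> (\<exists>g. g analytic_on {0} \<and> g 0 \<noteq> 0 \<and>
     (\<forall>\<^sub>F w in nhds 0. f (param_at z w) = param_at (f z) (w ^ m * g w)))"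

lemma param_at_0 [simp]: "param_at z 0 = z"
  by (cases z) auto

lemma coord_at_param_at [simp]: "coord_at z (param_at z w) = w"
  by (cases z) auto

text \<open>At $w = 0$ the normal form with $m = 0$ would move $f(z)$ to a different point.\<close>

lemma local_form_pos:
  assumes "local_form f z m"
  shows "m > 0"
proof (rule ccontr)
  assume "\<not> m > 0"
  then obtain g where g: "g 0 \<noteq> 0" "\<forall>\<^sub>F w in nhds 0. f (param_at z w) = param_at (f z) (g w)"
    using assms unfolding local_form_def by auto
  have "f z = param_at (f z) (g 0)"
    using eventually_nhds_x_imp_x[OF g(2)] by simp
  then have "coord_at (f z) (param_at (f z) 0) = coord_at (f z) (param_at (f z) (g 0))"
    by simp
  then show False
    using g(1) unfolding coord_at_param_at by simp
qed

lemma local_form_imp_local_degree: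
  assumes "local_form f z m"
  shows "local_degree f z = m"
proof -
  obtain g where g: "g analytic_on {0}" "g 0 \<noteq> 0"
      "\<forall>\<^sub>F w in nhds 0. f (param_at z w) = param_at (f z) (w ^ m * g w)"
    using assms unfolding local_form_def by blast
  obtain S where S: "open S" "0 \<in> S" "g holomorphic_on S"
    using g(1) unfolding analytic_at by blast
  obtain T where T: "open T" "0 \<in> T" "\<And>w. w \<in> T \<Longrightarrow> f (param_at z w) = param_at (f z) (w ^ m * g w)"
    using g(3) unfolding eventually_nhds by blast
  have "zorder (\<lambda>w. coord_at (f z) (f (param_at z w))) 0 = int m"
  proof (rule zorder_eqI)
    show "open (S \<inter> T)" "0 \<in> S \<inter> T" "g holomorphic_on (S \<inter> T)" "g 0 \<noteq> 0"
      using S T g(2) by (auto intro: holomorphic_on_subset)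
    fix w assume "w \<in> S \<inter> T" "w \<noteq> 0"
    then show "coord_at (f z) (f (param_at z w)) = g w * (w - 0) powi int m"
      using T(3)[of w] by simp
  qed
  then show ?thesis
    unfolding local_degree_def by simp
qed

lemma local_form_comp:
  assumes "local_form g z k" "local_form f (g z) m"
  shows "local_form (f \<circ> g) z (k * m)"
proof -
  obtain u where u: "u analytic_on {0}" "u 0 \<noteq> 0"
      "\<forall>\<^sub>F w in nhds 0. g (param_at z w) = param_at (g z) (w ^ k * u w)"
    using assms(1) unfolding local_form_def by blast
  obtain v where v: "v analytic_on {0}" "v 0 \<noteq> 0"
      "\<forall>\<^sub>F w in nhds 0. f (param_at (g z) w) = param_at (f (g z)) (w ^ m * v w)"
    using assms(2) unfolding local_form_def by blast
  define t where "t = (\<lambda>w. w ^ k * u w)"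
  have t: "t analytic_on {0}"
    unfolding t_def by (intro analytic_intros u(1))
  have t0: "t 0 = 0"
    using local_form_pos[OF assms(1)] by (simp add: t_def)
  have "(t \<longlongrightarrow> 0) (nhds 0)"
    using analytic_at_imp_isCont[OF t] t0 unfolding isCont_def by (metis tendsto_at_iff_tendsto_nhds)
  then have "\<forall>\<^sub>F w in nhds 0. f (param_at (g z) (t w)) = param_at (f (g z)) (t w ^ m * v (t w))"
    using v(3) by (rule eventually_compose_filterlim[rotated])
  then have "\<forall>\<^sub>F w in nhds 0. (f \<circ> g) (param_at z w) =
      param_at ((f \<circ> g) z) (w ^ (k * m) * (u w ^ m * v (t w)))"
    using u(3) by eventually_elim (simp add: t_def power_mult_distrib power_mult mult.assoc)
  moreover have "(v \<circ> t) analytic_on {0}"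
    using t v(1) t0 by (intro analytic_on_compose) auto
  then have "(\<lambda>w. u w ^ m * v (t w)) analytic_on {0}"
    unfolding o_def by (intro analytic_intros u(1))
  moreover have "u 0 ^ m * v (t 0) \<noteq> 0"
    using u(2) v(2) t0 by simp
  ultimately show ?thesis
    unfolding local_form_def by blast
qed

section \<open>Fibres and local degrees of rational maps\<close>

text \<open>The polynomial whose roots, with multiplicity, are the finite part of the fibre over \<open>w\<close>. The drop
of its degree below the degree of the map is the multiplicity of infinity in that fibre.\<close>

definition pencil :: "complex poly \<Rightarrow> complex poly \<Rightarrow> cp1 \<Rightarrow> complex poly" where
  "pencil p q w = (case w of None \<Rightarrow> q | Some b \<Rightarrow> p - smult b q)"

lemma pencil_nonzero:
  assumes "coprime p q" "max (degree p) (degree q) \<ge> 1"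
  shows "pencil p q w \<noteq> 0"
proof
  assume *: "pencil p q w = 0"
  show False
  proof (cases w)
    case None
    then have "q = 0" "is_unit p"
      using * assms(1) by (simp_all add: pencil_def)
    then show False
      using assms(2) is_unit_iff_degree[of p] by (cases "p = 0") auto
  next
    case (Some b)
    then have p: "p = smult b q"
      using * by (simp add: pencil_def)
    then have "q dvd p"
      by (simp add: dvd_smult)
    then have "is_unit q"
      using assms(1) by (metis coprime_absorb_left coprime_commute)
    then have "degree q = 0"
      using is_unit_iff_degree[of q] by (cases "q = 0") auto
    then show False
      using assms(2) p degree_smult_le[of b q] by simp
  qed
qed

lemma pencil_eq_0_iff:
  assumes "poly p a \<noteq> 0 \<or> poly q a \<noteq> 0"
  shows "poly (pencil p q w) a = 0 \<longleftrightarrow> pt (poly p a) (poly q a) = w"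
  using assms by (auto simp: pencil_def pt_def field_simps split: option.splits)

text \<open>Splitting off $(x - a)^m$ from the pencil member through $f(z)$ leaves a cofactor that does not
vanish at $a$; divided by \<open>q\<close>, or by \<open>p\<close> at a pole, it is the unit of the normal form. The shift $a$
allows one statement for both charts: the chart at infinity uses the reversed polynomials and
$a = 0$.\<close>

lemma local_form_ratio:
  assumes f: "\<And>w. f (param_at z w) = pt (poly p (a + w)) (poly q (a + w))"
    and nz: "poly p a \<noteq> 0 \<or> poly q a \<noteq> 0"
    and L: "pencil p q (f z) \<noteq> 0"
  shows "local_form f z (order a (pencil p q (f z)))"
proof -
  define L where "L = pencil p q (f z)"
  define m where "m = order a L"
  obtain R where R: "L = [:-a, 1:] ^ m * R" "\<not> [:-a, 1:] dvd R"
    using order_decomp[of L a] L unfolding L_def m_def by blast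
  have Ra: "poly R a \<noteq> 0"
    using R(2) poly_eq_0_iff_dvd by blast
  have Lw: "poly L (a + w) = w ^ m * poly R (a + w)" for w
    unfolding R(1) by (simp add: poly_power)
  have fz: "f z = pt (poly p a) (poly q a)"
    using f[of 0] by simp
  have near: "\<forall>\<^sub>F w in nhds 0. poly s (a + w) \<noteq> 0" if "poly s a \<noteq> 0" for s
  proof -
    have "isCont (\<lambda>w. poly s (a + w)) 0"
      by (intro continuous_intros)
    then have "((\<lambda>w. poly s (a + w)) \<longlongrightarrow> poly s a) (nhds 0)"
      using tendsto_at_iff_tendsto_nhds[of "\<lambda>w. poly s (a + w)" 0] by (simp add: isCont_def)
    then show ?thesis
      using that by (rule tendsto_imp_eventually_ne)
  qed
  have an: "(\<lambda>w. poly s (a + w)) analytic_on {0}" for s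
  proof -
    have "(\<lambda>w. poly s (a + w)) holomorphic_on UNIV"
      by (intro holomorphic_intros)
    then show ?thesis
      unfolding analytic_at by blast
  qed
  show ?thesis
  proof (cases "poly q a = 0")
    case True
    then have "f z = None" "L = q" "poly p a \<noteq> 0"
      using fz nz by (auto simp: pt_def L_def pencil_def)
    have "\<forall>\<^sub>F w in nhds 0. f (param_at z w) = param_at (f z) (w ^ m * (poly R (a + w) / poly p (a + w)))"
      using near[OF \<open>poly p a \<noteq> 0\<close>]
    proof eventually_elim
      case (elim w)
      have "w ^ m * (poly R (a + w) / poly p (a + w)) = poly q (a + w) / poly p (a + w)"
        using Lw[of w] \<open>L = q\<close> by simp
      then show ?case
        using elim unfolding f \<open>f z = None\<close> by (simp add: pt_def)
    qed
    moreover have "(\<lambda>w. poly R (a + w) / poly p (a + w)) analytic_on {0}"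
      using \<open>poly p a \<noteq> 0\<close> by (intro analytic_on_divide an) auto
    ultimately show ?thesis
      using Ra \<open>poly p a \<noteq> 0\<close> unfolding local_form_def L_def[symmetric] m_def[symmetric]
      by (intro exI[of _ "\<lambda>w. poly R (a + w) / poly p (a + w)"]) simp
  next
    case False
    define b where "b = poly p a / poly q a"
    have "f z = Some b" "L = p - smult b q"
      using fz False by (auto simp: pt_def L_def pencil_def b_def)
    have "\<forall>\<^sub>F w in nhds 0. f (param_at z w) = param_at (f z) (w ^ m * (poly R (a + w) / poly q (a + w)))"
      using near[OF False]
    proof eventually_elim
      case (elim w)
      have "w ^ m * poly R (a + w) = poly p (a + w) - b * poly q (a + w)"
        using Lw[of w] \<open>L = p - smult b q\<close> by simp
      then have "w ^ m * (poly R (a + w) / poly q (a + w)) = poly p (a + w) / poly q (a + w) - b"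
        using elim by (simp add: field_simps)
      then show ?case
        using elim unfolding f \<open>f z = Some b\<close> by (simp add: pt_def)
    qed
    moreover have "(\<lambda>w. poly R (a + w) / poly q (a + w)) analytic_on {0}"
      using False by (intro analytic_on_divide an) auto
    ultimately show ?thesis
      using Ra False unfolding local_form_def L_def[symmetric] m_def[symmetric]
      by (intro exI[of _ "\<lambda>w. poly R (a + w) / poly q (a + w)"]) simp
  qed
qed

text \<open>Reversal in a degree above the actual one contributes a power of $x$; this is the multiplicity of
the point at infinity.\<close>

lemma hom_comp_reversal:
  assumes "degree p \<le> n"
  shows "hom_comp n p 1 [:0, 1:] = monom 1 (n - degree p) * reflect_poly p"
proof (rule ccontr)
  define D where "D = hom_comp n p 1 [:0, 1:] - monom 1 (n - degree p) * reflect_poly p"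
  assume "\<not> ?thesis"
  then have "finite {w. poly D w = 0}"
    unfolding D_def by (intro poly_roots_finite) simp
  moreover have "poly D w = 0" if "w \<noteq> 0" for w
  proof -
    have "w ^ n = w ^ (n - degree p) * w ^ degree p"
      using assms by (simp flip: power_add)
    then show ?thesis
      using that assms
      by (simp add: D_def poly_hom_comp hom_eval_affine poly_monom poly_reflect_poly_nz inverse_eq_divide)
  qed
  then have "UNIV - {0} \<subseteq> {w. poly D w = 0}"
    by blast
  ultimately show False
    using finite_subset infinite_UNIV_char_0[where 'a = complex] by (metis finite_Diff2 finite.emptyI finite_insert)
qed

lemma order_0_reversal:
  assumes "degree p \<le> n" "p \<noteq> 0"
  shows "order 0 (hom_comp n p 1 [:0, 1:]) = n - degree p"
proof -
  have "order 0 (reflect_poly p) = 0"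
    using assms(2) by (intro order_0I) simp
  then show ?thesis
    using assms unfolding hom_comp_reversal[OF assms(1)] by (subst order_mult) auto
qed

lemma pencil_hom_comp:
  "pencil (hom_comp n p r s) (hom_comp n q r s) w = hom_comp n (pencil p q w) r s"
proof (cases w)
  case (Some b)
  have "poly (hom_comp n p r s - smult b (hom_comp n q r s)) z = poly (hom_comp n (p - smult b q) r s) z" for z
    by (simp add: poly_hom_comp hom_eval_def sum_distrib_left algebra_simps sum_subtractf)
  then have "hom_comp n p r s - smult b (hom_comp n q r s) = hom_comp n (p - smult b q) r s"
    unfolding poly_eq_poly_eq_iff[symmetric] by (rule ext)
  then show ?thesis
    using Some by (simp add: pencil_def)
qed (simp add: pencil_def)

lemma degree_pencil_le: "degree (pencil p q w) \<le> max (degree p) (degree q)"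
  by (cases w) (auto simp: pencil_def intro!: degree_diff_le degree_smult_le[THEN order_trans])

locale rational_map =
  fixes p q :: "complex poly" and f :: "cp1 \<Rightarrow> cp1" and n :: nat
  assumes coprime: "coprime p q" and f_def: "f = rat_map p q"
    and n_def: "n = max (degree p) (degree q)" and n_pos: "n \<ge> 1"
begin

lemma L_nonzero: "pencil p q w \<noteq> 0"
  using pencil_nonzero coprime n_def n_pos by blast

lemma f_Some_eq_iff: "f (Some a) = w \<longleftrightarrow> poly (pencil p q w) a = 0"
  using pencil_eq_0_iff[OF coprime_poly_0[OF coprime]] by (simp add: f_def rat_map_Some)

lemma f_None_eq_iff: "f None = w \<longleftrightarrow> degree (pencil p q w) < n"
proof -
  have "coeff (pencil p q w) n = 0 \<longleftrightarrow> f None = w"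
    using coprime_top_coeff[OF coprime n_def] unfolding f_def rat_map_None n_def[symmetric]
    by (auto simp: pencil_def pt_def field_simps split: option.splits)
  moreover have "coeff (pencil p q w) n = 0 \<longleftrightarrow> degree (pencil p q w) < n"
    using degree_pencil_le[of p q w] L_nonzero[of w] unfolding n_def[symmetric]
    by (metis coeff_eq_0 le_neq_implies_less leading_coeff_0_iff)
  ultimately show ?thesis by blast
qed

lemma local_form_Some: "local_form f (Some a) (order a (pencil p q (f (Some a))))"
  by (rule local_form_ratio)
    (use coprime_poly_0[OF coprime] L_nonzero in \<open>auto simp: f_def rat_map_Some\<close>)

lemma local_form_None: "local_form f None (n - degree (pencil p q (f None)))"
proof -
  define P where "P = hom_comp n p 1 [:0, 1:]"
  define Q where "Q = hom_comp n q 1 [:0, 1:]"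
  have L: "pencil P Q w = hom_comp n (pencil p q w) 1 [:0, 1:]" for w
    unfolding P_def Q_def by (rule pencil_hom_comp)
  have "param_at None w = pt 1 w" for w
    by (simp add: pt_def)
  then have "f (param_at None w) = pt (poly P (0 + w)) (poly Q (0 + w))" for w
    unfolding f_def P_def Q_def using rat_map_pt[OF _ n_def, of 1 w] by (simp add: poly_hom_comp)
  moreover have "poly P 0 \<noteq> 0 \<or> poly Q 0 \<noteq> 0"
    unfolding P_def Q_def poly_hom_comp using hom_eval_coprime[OF coprime n_def, of 1 0] by simp
  moreover have "pencil P Q (f None) \<noteq> 0"
    unfolding L using degree_pencil_le[of p q] L_nonzero
    by (subst hom_comp_reversal) (auto simp: n_def monom_eq_0_iff)
  ultimately have "local_form f None (order 0 (pencil P Q (f None)))"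
    by (rule local_form_ratio)
  then show ?thesis
    unfolding L using degree_pencil_le[of p q] L_nonzero by (simp add: order_0_reversal n_def)
qed

lemma local_degree_Some: "local_degree f (Some a) = order a (pencil p q (f (Some a)))"
  by (rule local_form_imp_local_degree[OF local_form_Some])

lemma local_degree_None: "local_degree f None = n - degree (pencil p q (f None))"
  by (rule local_form_imp_local_degree[OF local_form_None])

lemma local_form_local_degree: "local_form f z (local_degree f z)"
  using local_form_None local_form_Some by (cases z) (simp_all add: local_degree_Some local_degree_None)

lemma fibre: "{z. f z = w} = Some ` {a. poly (pencil p q w) a = 0} \<union> (if degree (pencil p q w) < n then {None} else {})"
proof (intro set_eqI iffI)
  fix z assume "z \<in> {z. f z = w}"
  then show "z \<in> Some ` {a. poly (pencil p q w) a = 0} \<union> (if degree (pencil p q w) < n then {None} else {})"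
    using f_Some_eq_iff f_None_eq_iff by (cases z) auto
qed (auto simp: f_Some_eq_iff f_None_eq_iff split: if_splits)

lemma finite_fibre: "finite {z. f z = w}"
  unfolding fibre using poly_roots_finite[OF L_nonzero] by auto

text \<open>The roots of the pencil member account for its degree, and infinity for the missing part.\<close>

lemma sum_local_degree_fibre: "(\<Sum>z | f z = w. local_degree f z) = n"
proof -
  define L where "L = pencil p q w"
  define R where "R = {a. poly L a = 0}"
  have [simp]: "finite R"
    unfolding R_def L_def by (rule poly_roots_finite[OF L_nonzero])
  have "degree L = degree (smult (lead_coeff L) (\<Prod>a\<in>R. [:-a, 1:] ^ order a L))"
    unfolding R_def complex_poly_decompose ..
  also have "\<dots> = (\<Sum>a\<in>R. order a L)"
    using L_nonzero[of w] by (simp add: degree_prod_sum_eq degree_power_eq L_def)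
  finally have deg: "degree L = (\<Sum>a\<in>R. order a L)" .
  have "(\<Sum>z\<in>Some ` R. local_degree f z) = (\<Sum>a\<in>R. order a L)"
    by (subst sum.reindex) (auto simp: local_degree_Some R_def L_def f_Some_eq_iff[symmetric] intro!: sum.cong)
  moreover have "(\<Sum>z | f z = w. local_degree f z) =
      (\<Sum>z\<in>Some ` R. local_degree f z) + (\<Sum>z\<in>(if degree L < n then {None} else {}). local_degree f z)"
    unfolding fibre L_def[symmetric] R_def[symmetric] by (intro sum.union_disjoint) auto
  moreover have "(\<Sum>z\<in>(if degree L < n then {None} else {}). local_degree f z) = n - degree L"
    using f_None_eq_iff[of w] by (auto simp: local_degree_None L_def)
  ultimately show ?thesis
    using degree_pencil_le[of p q w] deg unfolding L_def n_def by simp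
qed

lemma local_degree_le: "local_degree f z \<le> n"
proof -
  have "local_degree f z \<le> (\<Sum>y | f y = f z. local_degree f y)"
    by (rule member_le_sum) (auto simp: finite_fibre)
  then show ?thesis
    by (simp add: sum_local_degree_fibre)
qed

end

section \<open>The Riemann-Hurwitz inequality\<close>

lemma order_le_pderiv:
  fixes p :: "complex poly"
  assumes "pderiv p \<noteq> 0"
  shows "order a p - 1 \<le> order a (pderiv p)"
proof (cases "poly p a = 0")
  case True
  have "p \<noteq> 0"
    using assms by auto
  then show ?thesis
    using order_pderiv[OF _ True] by simp
qed (simp add: order_0I)

text \<open>A root of order $m$ of $L$ is a root of order at least $m - 1$ of $L'$.\<close>

lemma power_dvd_wronskian:
  fixes L M :: "complex poly"
  shows "[:-a, 1:] ^ (order a L - 1) dvd pderiv L * M - L * pderiv M"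
proof (rule dvd_diff)
  show "[:-a, 1:] ^ (order a L - 1) dvd pderiv L * M"
    using order_le_pderiv[of L a] by (intro dvd_mult2) (auto simp: order_divides)
  show "[:-a, 1:] ^ (order a L - 1) dvd L * pderiv M"
    by (intro dvd_mult2) (auto simp: order_divides)
qed

lemma degree_wronskian_le:
  fixes L M :: "complex poly"
  shows "degree (pderiv L * M - L * pderiv M) \<le> degree L + degree M - 1"
proof (rule degree_diff_le)
  show "degree (pderiv L * M) \<le> degree L + degree M - 1"
  proof (cases "degree L = 0")
    case True
    then have "pderiv L = 0" by (simp add: pderiv_eq_0_iff)
    then show ?thesis by simp
  next
    case False
    then show ?thesis
      using degree_mult_le[of "pderiv L" M] by (simp add: degree_pderiv)
  qed
  show "degree (L * pderiv M) \<le> degree L + degree M - 1"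
  proof (cases "degree M = 0")
    case True
    then have "pderiv M = 0" by (simp add: pderiv_eq_0_iff)
    then show ?thesis by simp
  next
    case False
    then show ?thesis
      using degree_mult_le[of L "pderiv M"] by (simp add: degree_pderiv)
  qed
qed

text \<open>At a root of \<open>q\<close> the left side vanishes to at least the order of \<open>q\<close>, the right side to one less.\<close>

lemma wronskian_nonzero_aux:
  fixes p q :: "complex poly"
  assumes "coprime p q" "degree q > 0"
  shows "pderiv p * q \<noteq> p * pderiv q"
proof
  assume eq: "pderiv p * q = p * pderiv q"
  obtain a where a: "poly q a = 0"
    using alg_closed_imp_poly_has_root[OF assms(2)] by blast
  then have pa: "poly p a \<noteq> 0"
    using coprime_poly_0[OF assms(1)] by blast
  have "q \<noteq> 0" "pderiv q \<noteq> 0" "p \<noteq> 0"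
    using assms(2) pa by (auto simp: pderiv_eq_0_iff)
  then have nz: "p * pderiv q \<noteq> 0"
    by simp
  have "order a q \<le> order a (pderiv p * q)"
    using nz unfolding eq[symmetric] by (subst order_mult) auto
  also have "\<dots> = order a (pderiv q)"
    unfolding eq using nz pa by (subst order_mult) (auto simp: order_0I)
  finally show False
    using order_pderiv[OF \<open>q \<noteq> 0\<close> a] by simp
qed

context rational_map
begin

lemma wronskian_nonzero: "pderiv p * q - p * pderiv q \<noteq> 0"
proof (cases "degree q > 0")
  case True
  then show ?thesis
    using wronskian_nonzero_aux[OF coprime] by simp
next
  case False
  then have "degree p > 0"
    using n_def n_pos by simp
  moreover have "Rings.coprime q p"
    using coprime by (simp add: coprime_commute)
  ultimately show ?thesis
    using wronskian_nonzero_aux[of q p] by (simp add: mult.commute)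
qed

text \<open>Replacing a generator of the pencil by another member changes the Wronskian only by a sign. Hence a
single polynomial sees the ramification over every point.\<close>

lemma wronskian_pencil:
  obtains M where "pderiv p * q - p * pderiv q = pderiv (pencil p q w) * M - pencil p q w * pderiv M \<or>
      pderiv p * q - p * pderiv q = - (pderiv (pencil p q w) * M - pencil p q w * pderiv M)"
    and "degree M \<le> n"
proof (cases w)
  case None
  then show ?thesis
    using that[of p] by (simp add: pencil_def n_def algebra_simps)
next
  case (Some b)
  then show ?thesis
    using that[of q] by (simp add: pencil_def n_def algebra_simps pderiv_diff pderiv_smult)
qed

text \<open>The Wronskian $W = p'q - pq'$ vanishes at a finite point $a$ to order at least $\deg_a f - 1$, so the
finite ramification is at most $\deg W$. Writing $W$ with the pencil member through $f(\infty)$, whose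
degree is $n - \deg_\infty f$, gives $\deg W \le 2n - 1 - \deg_\infty f$, which leaves room for the
ramification at infinity.\<close>

lemma riemann_hurwitz_le:
  assumes "finite F"
  shows "(\<Sum>z\<in>F. local_degree f z - 1) \<le> 2 * n - 2"
proof -
  define W where "W = pderiv p * q - p * pderiv q"
  have W: "W \<noteq> 0"
    unfolding W_def by (rule wronskian_nonzero)
  have ord: "local_degree f (Some a) - 1 \<le> order a W" for a
  proof -
    obtain M where "W = pderiv (pencil p q (f (Some a))) * M - pencil p q (f (Some a)) * pderiv M \<or>
        W = - (pderiv (pencil p q (f (Some a))) * M - pencil p q (f (Some a)) * pderiv M)"
      using wronskian_pencil[of "f (Some a)"] unfolding W_def by blast
    then have "[:-a, 1:] ^ (local_degree f (Some a) - 1) dvd W"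
      using power_dvd_wronskian[of a "pencil p q (f (Some a))" M] unfolding local_degree_Some
      by (metis dvd_minus_iff)
    then show ?thesis
      using W by (simp add: order_divides)
  qed
  have deg: "degree W + (local_degree f None - 1) \<le> 2 * n - 2"
  proof -
    define L where "L = pencil p q (f None)"
    obtain M where M: "W = pderiv L * M - L * pderiv M \<or> W = - (pderiv L * M - L * pderiv M)" "degree M \<le> n"
      using wronskian_pencil[of "f None"] unfolding W_def L_def by blast
    then have "degree W \<le> degree L + degree M - 1"
      using degree_wronskian_le[of L M] by (metis degree_minus)
    moreover have "degree L < n"
      using f_None_eq_iff[of "f None"] unfolding L_def by simp
    ultimately show ?thesis
      using M(2) unfolding local_degree_None L_def[symmetric] by linarith
  qed
  define F' where "F' = {a. Some a \<in> F}"
  have fin: "finite F'"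
    unfolding F'_def using finite_vimageI[OF assms, of Some] by (simp add: vimage_def)
  have "F \<subseteq> insert None (Some ` F')"
  proof
    fix z assume "z \<in> F"
    then show "z \<in> insert None (Some ` F')"
      unfolding F'_def by (cases z) auto
  qed
  then have "(\<Sum>z\<in>F. local_degree f z - 1) \<le> (\<Sum>z\<in>insert None (Some ` F'). local_degree f z - 1)"
    using fin by (intro sum_mono2) auto
  also have "\<dots> = (local_degree f None - 1) + (\<Sum>a\<in>F'. local_degree f (Some a) - 1)"
    using fin by (subst sum.insert) (auto simp: sum.reindex)
  also have "(\<Sum>a\<in>F'. local_degree f (Some a) - 1) \<le> (\<Sum>a\<in>F'. order a W)"
    by (intro sum_mono ord)
  also have "\<dots> \<le> (\<Sum>a\<in>F' \<union> {a. poly W a = 0}. order a W)"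
    using fin poly_roots_finite[OF W] by (intro sum_mono2) auto
  also have "\<dots> = (\<Sum>a | poly W a = 0. order a W)"
    using fin poly_roots_finite[OF W] by (intro sum.mono_neutral_right) (auto simp: order_0I)
  also have "\<dots> \<le> degree W"
    by (rule sum_order_le_degree[OF W])
  finally show ?thesis
    using deg by simp
qed

end

lemma rational_of_degree_obtain:
  assumes "rational_of_degree f n" "n \<ge> 1"
  obtains p q where "rational_map p q f n"
  using assms unfolding rational_of_degree_def rational_map_def by blast

lemma local_degree_comp:
  assumes "rational_of_degree f m" "m \<ge> 1" "rational_of_degree g k" "k \<ge> 1"
  shows "local_degree (f \<circ> g) z = local_degree f (g z) * local_degree g z"
proof -
  have "local_form h x (local_degree h x)" if "rational_of_degree h j" "j \<ge> 1" for h j x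
    using rational_of_degree_obtain[OF that] rational_map.local_form_local_degree by metis
  then have "local_form (f \<circ> g) z (local_degree g z * local_degree f (g z))"
    using assms by (intro local_form_comp) blast+
  then show ?thesis
    using local_form_imp_local_degree by (simp add: mult.commute)
qed

lemma local_degree_id: "local_degree id z = 1"
  by (rule local_form_imp_local_degree)
    (auto simp: local_form_def intro!: exI[of _ "\<lambda>_. 1"] analytic_intros)

text \<open>The local degrees of a Moebius map and of its inverse multiply to the local degree of the
identity.\<close>

lemma local_degree_moebius:
  assumes "a * d - b * c \<noteq> 0"
  shows "local_degree (moebius a b c d) z = 1"
proof -
  have "d * a - (- b) * (- c) \<noteq> 0"
    using assms by (simp add: mult.commute)
  then have "local_degree (moebius d (- b) (- c) a \<circ> moebius a b c d) z =
      local_degree (moebius d (- b) (- c) a) (moebius a b c d z) * local_degree (moebius a b c d) z"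
    using rational_of_degree_moebius[OF assms] rational_of_degree_moebius[of d a "- b" "- c"]
    by (intro local_degree_comp[of _ 1 _ 1]) auto
  then show ?thesis
    unfolding moebius_inverse[OF assms] local_degree_id by simp
qed

section \<open>Recognizing power maps\<close>

lemma bij_moebius:
  assumes "a * d - b * c \<noteq> 0"
  shows "bij (moebius a b c d)"
  using moebius_inverse[OF assms] by (rule o_bij[rotated])

lemma rational_of_degree_conjugate:
  assumes det: "a * d - b * c \<noteq> 0" and f: "rational_of_degree f n" "n \<ge> 1"
  shows "rational_of_degree (inv (moebius a b c d) \<circ> f \<circ> moebius a b c d) n"
proof -
  have "rational_of_degree (inv (moebius a b c d)) 1"
    unfolding inv_moebius[OF det] using det rational_of_degree_moebius[of d a "- b" "- c"]
    by (simp add: mult.commute)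
  then have "rational_of_degree (inv (moebius a b c d) \<circ> f) (1 * n)"
    by (rule rational_of_degree_comp[OF _ f(1) le_refl f(2)])
  then have "rational_of_degree (inv (moebius a b c d) \<circ> f \<circ> moebius a b c d) (1 * n * 1)"
    using f(2) by (intro rational_of_degree_comp[OF _ rational_of_degree_moebius[OF det]]) auto
  then show ?thesis by simp
qed

lemma moebius_conjugate_trans:
  assumes \<mu>: "a * d - b * c \<noteq> 0"
    and "moebius_conjugate (inv (moebius a b c d) \<circ> f \<circ> moebius a b c d) g"
  shows "moebius_conjugate f g"
proof -
  define M where "M = moebius a b c d"
  obtain a' b' c' d' where \<sigma>: "a' * d' - b' * c' \<noteq> 0"
      "inv M \<circ> f \<circ> M = moebius a' b' c' d' \<circ> g \<circ> inv (moebius a' b' c' d')"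
    using assms(2) unfolding moebius_conjugate_def M_def by blast
  define S where "S = moebius a' b' c' d'"
  have bij: "bij M" "bij S"
    unfolding M_def S_def by (rule bij_moebius[OF \<mu>], rule bij_moebius[OF \<sigma>(1)])
  have MM: "M \<circ> inv M = id"
    using bij(1) by (metis bij_is_surj surj_iff)
  have "f = (M \<circ> inv M) \<circ> f \<circ> (M \<circ> inv M)"
    unfolding MM by simp
  also have "\<dots> = M \<circ> (inv M \<circ> f \<circ> M) \<circ> inv M"
    by (simp add: comp_assoc)
  also have "\<dots> = (M \<circ> S) \<circ> g \<circ> (inv S \<circ> inv M)"
    unfolding \<sigma>(2) S_def[symmetric] by (simp add: comp_assoc)
  also have "inv S \<circ> inv M = inv (M \<circ> S)"
    by (rule o_inv_distrib[OF bij, symmetric])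
  finally show ?thesis
    unfolding moebius_conjugate_def M_def S_def moebius_comp[OF \<mu> \<sigma>(1)]
    using moebius_det_comp[OF \<mu> \<sigma>(1)] by blast
qed

lemma moebius_conjugateI:
  assumes "a * d - b * c \<noteq> 0" "f \<circ> moebius a b c d = moebius a b c d \<circ> g"
  shows "moebius_conjugate f g"
proof -
  have "f = f \<circ> (moebius a b c d \<circ> inv (moebius a b c d))"
    using bij_moebius[OF assms(1)] by (metis bij_is_surj surj_iff comp_id)
  also have "\<dots> = moebius a b c d \<circ> g \<circ> inv (moebius a b c d)"
    unfolding comp_assoc[symmetric] assms(2) ..
  finally show ?thesis
    unfolding moebius_conjugate_def using assms(1) by blast
qed

lemma hom_eval_monom: "hom_eval n (monom k n) u v = k * u ^ n"
proof -
  have "hom_eval n (monom k n) u v = (\<Sum>i\<in>{n}. coeff (monom k n) i * u ^ i * v ^ (n - i))"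
    unfolding hom_eval_def by (intro sum.mono_neutral_right) auto
  then show ?thesis by simp
qed

lemma hom_eval_1: "hom_eval n 1 u v = v ^ n"
proof -
  have "hom_eval n 1 u v = (\<Sum>i\<in>{0}. coeff 1 i * u ^ i * v ^ (n - i))"
    unfolding hom_eval_def by (intro sum.mono_neutral_right) auto
  then show ?thesis by simp
qed

text \<open>A scaling normalizes the leading coefficient. The scaling factor solves
$k \alpha^{n-1} = 1$ in the polynomial case and $k \beta^{n+1} = 1$ in the other.\<close>

lemma power_map_conjugate:
  assumes "n \<ge> 2" "k \<noteq> 0"
  shows "moebius_conjugate (rat_map (monom k n) 1) (rat_map (monom 1 n) 1)"
    and "moebius_conjugate (rat_map 1 (monom k n)) (rat_map 1 (monom 1 n))"
proof -
  have "n \<noteq> 0"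
    using assms(1) by simp
  obtain \<alpha> :: complex where "\<alpha> ^ (n - 1) = 1 / k"
    using nth_root_exists[of "n - 1" "1 / k"] assms(1) by auto
  then have \<alpha>: "k * \<alpha> ^ n = \<alpha>" "\<alpha> \<noteq> 0"
    using assms power_Suc[of \<alpha> "n - 1"] by (auto simp: power_0_left)
  show "moebius_conjugate (rat_map (monom k n) 1) (rat_map (monom 1 n) 1)"
  proof (rule moebius_conjugateI)
    show "\<alpha> * 1 - 0 * 0 \<noteq> 0"
      using \<alpha>(2) by simp
    show "rat_map (monom k n) 1 \<circ> moebius \<alpha> 0 0 1 = moebius \<alpha> 0 0 1 \<circ> rat_map (monom 1 n) 1"
    proof
      fix x
      obtain u v where uv: "u \<noteq> 0 \<or> v \<noteq> 0" "x = pt u v"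
        by (rule pt_exhaust)
      have "rat_map (monom k n) 1 (moebius \<alpha> 0 0 1 x) = pt (k * \<alpha> ^ n * u ^ n) (v ^ n)"
        using uv \<alpha>(2) assms(2) moebius_pt[of \<alpha> 1 0 0 u v]
        by (simp add: rat_map_pt[of _ _ n] degree_monom_eq hom_eval_monom hom_eval_1 power_mult_distrib mult.assoc)
      also have "\<dots> = moebius \<alpha> 0 0 1 (rat_map (monom 1 n) 1 x)"
        using uv \<alpha> moebius_pt[of \<alpha> 1 0 0 "u ^ n" "v ^ n"] \<open>n \<noteq> 0\<close>
        by (simp add: rat_map_pt[of _ _ n] degree_monom_eq hom_eval_monom hom_eval_1)
      finally show "(rat_map (monom k n) 1 \<circ> moebius \<alpha> 0 0 1) x = (moebius \<alpha> 0 0 1 \<circ> rat_map (monom 1 n) 1) x"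
        by simp
    qed
  qed
  obtain \<beta> :: complex where "\<beta> ^ (n + 1) = 1 / k"
    using nth_root_exists[of "n + 1" "1 / k"] by auto
  then have \<beta>: "\<beta> * (k * \<beta> ^ n) = 1" "\<beta> \<noteq> 0"
    using assms by (auto simp: field_simps)
  show "moebius_conjugate (rat_map 1 (monom k n)) (rat_map 1 (monom 1 n))"
  proof (rule moebius_conjugateI)
    show "\<beta> * 1 - 0 * 0 \<noteq> 0"
      using \<beta>(2) by simp
    show "rat_map 1 (monom k n) \<circ> moebius \<beta> 0 0 1 = moebius \<beta> 0 0 1 \<circ> rat_map 1 (monom 1 n)"
    proof
      fix x
      obtain u v where uv: "u \<noteq> 0 \<or> v \<noteq> 0" "x = pt u v"
        by (rule pt_exhaust)
      have "rat_map 1 (monom k n) (moebius \<beta> 0 0 1 x) = pt (v ^ n) (k * \<beta> ^ n * u ^ n)"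
        using uv \<beta>(2) assms(2) moebius_pt[of \<beta> 1 0 0 u v]
        by (simp add: rat_map_pt[of _ _ n] degree_monom_eq hom_eval_monom hom_eval_1 power_mult_distrib mult.assoc)
      also have "\<dots> = pt (\<beta> * v ^ n) (u ^ n)"
        using uv \<beta> assms(2) by (subst pt_eq_iff) (auto simp: mult_ac)
      also have "\<dots> = moebius \<beta> 0 0 1 (rat_map 1 (monom 1 n) x)"
        using uv \<beta> moebius_pt[of \<beta> 1 0 0 "v ^ n" "u ^ n"] \<open>n \<noteq> 0\<close>
        by (simp add: rat_map_pt[of _ _ n] degree_monom_eq hom_eval_monom hom_eval_1 disj_commute)
      finally show "(rat_map 1 (monom k n) \<circ> moebius \<beta> 0 0 1) x = (moebius \<beta> 0 0 1 \<circ> rat_map 1 (monom 1 n)) x"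
        by simp
    qed
  qed
qed

lemma rat_map_smult:
  assumes "k \<noteq> 0"
  shows "rat_map (smult k p) (smult k q) = rat_map p q"
  using assms by (auto simp: rat_map_def fun_eq_iff Let_def split: option.splits)

lemma no_roots_imp_const:
  fixes p :: "complex poly"
  assumes "\<And>z. poly p z \<noteq> 0"
  obtains c where "p = [:c:]" "c \<noteq> 0"
proof -
  have "degree p = 0"
    using alg_closed_imp_poly_has_root[of p] assms by blast
  then obtain c where "p = [:c:]"
    by (rule degree_eq_zeroE)
  then show ?thesis
    using that assms[of 0] by simp
qed

lemma only_root_0_imp_monom:
  fixes p :: "complex poly"
  assumes "p \<noteq> 0" "\<And>z. poly p z = 0 \<Longrightarrow> z = 0"
  obtains k where "p = monom k (degree p)" "k \<noteq> 0"
proof -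
  define m where "m = order 0 p"
  obtain r where r: "p = [:-0, 1:] ^ m * r" "\<not> [:-0, 1:] dvd r"
    using order_decomp[OF assms(1), of 0] unfolding m_def by blast
  have "poly r z \<noteq> 0" for z
  proof
    assume z: "poly r z = 0"
    then have "poly p z = 0"
      unfolding r(1) by simp
    then have "z = 0"
      by (rule assms(2))
    then show False
      using z r(2) poly_eq_0_iff_dvd[of r 0] by simp
  qed
  then obtain k where k: "r = [:k:]" "k \<noteq> 0"
    by (rule no_roots_imp_const)
  have p: "p = monom k m"
    unfolding r(1) k(1) by (simp add: monom_altdef)
  have "degree p = m"
    unfolding p using k(2) by (rule degree_monom_eq)
  then show ?thesis
    using that[of k] p k(2) by simp
qed

text \<open>Move the pair to infinity and zero. Then numerator and denominator have no root except zero, and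
only one of them can have it; the other is constant.\<close>

lemma fully_invariant_pair_imp_power_map:
  assumes f: "rational_of_degree f n" "n \<ge> 2" and "x \<noteq> y"
    and inv: "\<And>z. f z \<in> {x, y} \<Longrightarrow> z \<in> {x, y}"
  shows "moebius_conjugate f (rat_map (monom 1 n) 1) \<or> moebius_conjugate f (rat_map 1 (monom 1 n))"
proof -
  obtain u v where x: "u \<noteq> 0 \<or> v \<noteq> 0" "x = pt u v"
    by (rule pt_exhaust)
  obtain u' v' where y: "u' \<noteq> 0 \<or> v' \<noteq> 0" "y = pt u' v'"
    by (rule pt_exhaust)
  have det: "u * v' - u' * v \<noteq> 0"
    using pt_eq_iff[OF x(1) y(1)] \<open>x \<noteq> y\<close> x(2) y(2) by auto
  define M where "M = moebius u u' v v'"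
  have bij: "bij M"
    unfolding M_def by (rule bij_moebius[OF det])
  have M: "M None = x" "M (Some 0) = y"
    unfolding M_def using moebius_pt[OF det, of 1 0] moebius_pt[OF det, of 0 1] x(2) y(2)
    by (simp_all add: pt_def)
  have "rational_of_degree (inv M \<circ> f \<circ> M) n"
    unfolding M_def using rational_of_degree_conjugate[OF det] f by simp
  then obtain p q where pq: "coprime p q" "inv M \<circ> f \<circ> M = rat_map p q" "q \<noteq> 0"
      and n: "n = max (degree p) (degree q)"
    unfolding rational_of_degree_def by blast
  have inv': "z \<in> {None, Some 0}" if "rat_map p q z \<in> {None, Some 0}" for z
  proof -
    have "M (rat_map p q z) = f (M z)"
      unfolding pq(2)[symmetric] using bij by (simp add: bij_is_surj surj_f_inv_f)
    then have "f (M z) \<in> {x, y}"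
      using that M by auto
    then have "M z \<in> {M None, M (Some 0)}"
      using inv[of "M z"] by (simp add: M)
    then show ?thesis
      using inj_eq[OF bij_is_inj[OF bij]] by simp
  qed
  have rq: "z = 0" if "poly q z = 0" for z
    using inv'[of "Some z"] that by (simp add: rat_map_def)
  have rp: "z = 0" if "poly p z = 0" for z
    using inv'[of "Some z"] that by (auto simp: rat_map_def)
  have "p \<noteq> 0"
    using rp[of 1] by auto
  have "moebius_conjugate (rat_map p q) (rat_map (monom 1 n) 1) \<or>
        moebius_conjugate (rat_map p q) (rat_map 1 (monom 1 n))"
  proof (cases "poly q 0 = 0")
    case True
    then have "poly p z \<noteq> 0" for z
      using coprime_poly_0[OF pq(1), of 0] rp by blast
    then obtain k where k: "p = [:k:]" "k \<noteq> 0"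
      by (rule no_roots_imp_const)
    have deg: "degree q = n"
      using n k by simp
    obtain l where l: "q = monom l n" "l \<noteq> 0"
      by (rule only_root_0_imp_monom[OF pq(3) rq, unfolded deg])
    have "rat_map p q = rat_map (smult k 1) (smult k (monom (l / k) n))"
      unfolding k(1) l(1) using k(2) by (simp add: smult_monom)
    then have "rat_map p q = rat_map 1 (monom (l / k) n)"
      unfolding rat_map_smult[OF k(2)] .
    moreover have "l / k \<noteq> 0"
      using l(2) k(2) by simp
    ultimately show ?thesis
      using power_map_conjugate(2)[OF f(2)] by simp
  next
    case False
    then have "poly q z \<noteq> 0" for z
      using rq by blast
    then obtain k where k: "q = [:k:]" "k \<noteq> 0"
      by (rule no_roots_imp_const)
    have deg: "degree p = n"
      using n k by simp
    obtain l where l: "p = monom l n" "l \<noteq> 0"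
      by (rule only_root_0_imp_monom[OF \<open>p \<noteq> 0\<close> rp, unfolded deg])
    have "rat_map p q = rat_map (smult k (monom (l / k) n)) (smult k 1)"
      unfolding k(1) l(1) using k(2) by (simp add: smult_monom)
    then have "rat_map p q = rat_map (monom (l / k) n) 1"
      unfolding rat_map_smult[OF k(2)] .
    moreover have "l / k \<noteq> 0"
      using l(2) k(2) by simp
    ultimately show ?thesis
      using power_map_conjugate(1)[OF f(2)] by simp
  qed
  then show ?thesis
    using moebius_conjugate_trans[OF det, of f] unfolding pq(2)[unfolded M_def] by blast
qed

section \<open>Chebyshev polynomials and the Pell equation\<close>

lemma poly_eqI_cos:
  assumes "\<And>t. poly p (cos t) = poly q (cos t)"
  shows "p = (q :: complex poly)"
proof -
  have "poly p z = poly q z" for z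
    using assms[of "Arccos z"] by simp
  then show ?thesis
    unfolding poly_eq_poly_eq_iff[symmetric] by blast
qed

lemma chebyshev_poly_rec:
  "chebyshev_poly (Suc (Suc k)) = [:0, 2:] * chebyshev_poly (Suc k) - chebyshev_poly k"
proof (rule poly_eqI_cos)
  fix t :: complex
  have "cos (of_nat (Suc (Suc k)) * t) = cos (of_nat (Suc k) * t + t)"
    by (simp add: algebra_simps)
  moreover have "cos (of_nat k * t) = cos (of_nat (Suc k) * t - t)"
    by (simp add: algebra_simps)
  ultimately show "poly (chebyshev_poly (Suc (Suc k))) (cos t) =
      poly ([:0, 2:] * chebyshev_poly (Suc k) - chebyshev_poly k) (cos t)"
    by (simp add: poly_chebyshev_poly cos_add cos_diff del: of_nat_Suc)
qed

lemma chebyshev_poly_0: "chebyshev_poly 0 = 1"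
  by (rule poly_eqI_cos) (simp add: poly_chebyshev_poly)

lemma chebyshev_poly_1: "chebyshev_poly (Suc 0) = [:0, 1:]"
  by (rule poly_eqI_cos) (simp add: poly_chebyshev_poly)

lemma degree_chebyshev_poly: "degree (chebyshev_poly k) = k"
proof (induction k rule: less_induct)
  case (less k)
  consider "k = 0" | "k = Suc 0" | j where "k = Suc (Suc j)"
    by (metis not0_implies_Suc)
  then show ?case
  proof cases
    case (3 j)
    have "degree ([:0, 2:] * chebyshev_poly (Suc j)) = Suc (Suc j)"
      using less[of "Suc j"] 3 by (subst degree_mult_eq) auto
    then have "degree ([:0, 2:] * chebyshev_poly (Suc j) + (- chebyshev_poly j)) = Suc (Suc j)"
      using less[of j] 3 by (subst degree_add_eq_left) auto
    then show ?thesis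
      unfolding 3 chebyshev_poly_rec by simp
  qed (simp_all add: chebyshev_poly_0 chebyshev_poly_1)
qed

text \<open>The solutions of $P^2 - (x^2 - 1) Q^2 = 1$ are, up to sign, the powers of the fundamental unit
$x + \sqrt{x^2 - 1}$, which is $e^{it}$ for $x = \cos t$. The proof is a descent on the degree: with
the sign of $Q$ such that the leading coefficients agree, dividing by the fundamental unit lowers the
degree. The exponent is an integer rather than a natural number so that changing the sign of $Q$ is
negation of the exponent.\<close>

lemma pell_solutions:
  fixes P Q :: "complex poly"
  assumes "P ^ 2 - [:-1, 0, 1:] * Q ^ 2 = 1"
  shows "\<exists>(k::int) e. e \<in> {1, -1} \<and>
    (\<forall>t. poly P (cos t) = e * cos (of_int k * t) \<and> poly Q (cos t) * sin t = e * sin (of_int k * t))"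
  using assms
proof (induction "degree P" arbitrary: P Q rule: less_induct)
  case less
  define D :: "complex poly" where "D = [:-1, 0, 1:]"
  have D: "D = [:0, 1:] ^ 2 - 1" "degree D = 2" "lead_coeff D = 1"
    by (simp_all add: D_def power2_eq_square one_pCons)
  have pell: "P ^ 2 - 1 = D * Q ^ 2"
    using less.prems by (simp add: D_def algebra_simps)
  show ?case
  proof (cases "degree P = 0")
    case True
    then obtain c where c: "P = [:c:]"
      by (rule degree_eq_zeroE)
    have "Q = 0"
    proof (rule ccontr)
      assume "Q \<noteq> 0"
      then have "degree (P ^ 2 - 1) = 2 + degree (Q ^ 2)"
        unfolding pell using D by (subst degree_mult_eq) auto
      moreover have "degree (P ^ 2 - 1) = 0"
        by (simp add: c power2_eq_square one_pCons)
      ultimately show False by simp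
    qed
    then have "c ^ 2 = 1"
      using pell by (simp add: c power2_eq_square one_pCons)
    then have "c \<in> {1, -1}"
      by (simp add: power2_eq_1_iff)
    then show ?thesis
      using c \<open>Q = 0\<close> by (intro exI[of _ 0] exI[of _ c]) simp
  next
    case False
    define d where "d = degree P"
    have "d > 0" "P \<noteq> 0"
      using False by (auto simp: d_def)
    have deg_lhs: "degree (P ^ 2 - 1) = 2 * d"
    proof -
      have "degree (P ^ 2 + (- 1)) = degree (P ^ 2)"
        using \<open>d > 0\<close> by (intro degree_add_eq_left) (simp add: degree_power_eq \<open>P \<noteq> 0\<close> d_def)
      then show ?thesis
        by (simp add: degree_power_eq \<open>P \<noteq> 0\<close> d_def)
    qed
    have "Q \<noteq> 0"
      using deg_lhs pell \<open>d > 0\<close> by auto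
    have dQ: "degree Q = d - 1"
    proof -
      have "D \<noteq> 0"
        using D(2) by auto
      then have "2 + 2 * degree Q = 2 * d"
        using deg_lhs \<open>Q \<noteq> 0\<close> D(2) unfolding pell by (simp add: degree_mult_eq degree_power_eq)
      then show ?thesis by simp
    qed
    have "lead_coeff (P ^ 2 - 1) = lead_coeff P ^ 2"
      using \<open>d > 0\<close> coeff_mult_degree_sum[of P P] unfolding deg_lhs
      by (simp add: power2_eq_square d_def mult_2)
    then have "lead_coeff P ^ 2 = lead_coeff Q ^ 2"
      unfolding pell using D by (simp add: lead_coeff_mult lead_coeff_power)
    then have lc: "lead_coeff P = lead_coeff Q \<or> lead_coeff P = lead_coeff (- Q)"
      by (simp add: power2_eq_iff)
    have core: "\<exists>(k::int) e. e \<in> {1, -1} \<and>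
        (\<forall>t. poly P (cos t) = e * cos (of_int k * t) \<and> poly R (cos t) * sin t = e * sin (of_int k * t))"
      if R: "P ^ 2 - 1 = D * R ^ 2" "degree R = d - 1" "lead_coeff P = lead_coeff R" for R
    proof -
      define X :: "complex poly" where "X = [:0, 1:]"
      \<comment> \<open>$P' + R' \sqrt D = (P + R \sqrt D)(x - \sqrt D)$, as $x - \sqrt D$ is the inverse of the
        fundamental unit.\<close>
      define P' where "P' = X * P - D * R"
      define R' where "R' = X * R - P"
      have DX: "D = X ^ 2 - 1"
        by (simp add: D X_def)
      have P2: "P ^ 2 = D * R ^ 2 + 1"
        using R(1) by (simp add: algebra_simps)
      have "P' ^ 2 - D * R' ^ 2 = (X ^ 2 - D) * (P ^ 2 - D * R ^ 2)"
        unfolding P'_def R'_def by (simp add: power2_eq_square algebra_simps)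
      then have pell': "P' ^ 2 - D * R' ^ 2 = 1"
        by (simp add: DX P2)
      have recover: "P = X * P' + D * R'" "R = X * R' + P'"
        unfolding P'_def R'_def DX by (simp_all add: power2_eq_square algebra_simps)
      have "degree P' < d"
      proof (cases "R' = 0")
        case True
        then have "P' ^ 2 = 1"
          using pell' by simp
        then have "degree P' = 0"
        proof -
          have "P' \<noteq> 0" "degree (P' ^ 2) = 0"
            using \<open>P' ^ 2 = 1\<close> by auto
          then show ?thesis
            by (simp add: degree_power_eq)
        qed
        then show ?thesis
          using \<open>d > 0\<close> by simp
      next
        case False
        \<comment> \<open>The leading terms cancel in $R' = xR - P$, so they add up in the conjugate factor
          $xR + P$; the product of the two has degree at most $2d - 2$.\<close>
        have "R' * (X * R + P) = X ^ 2 * R ^ 2 - P ^ 2"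
          unfolding R'_def by (simp add: power2_eq_square algebra_simps)
        also have "\<dots> = R ^ 2 - 1"
          unfolding P2 DX by (simp add: algebra_simps)
        finally have prod: "R' * (X * R + P) = R ^ 2 - 1" .
        have "coeff (X * R + P) d = lead_coeff R + lead_coeff P"
          using \<open>d > 0\<close> R(2) by (cases d) (auto simp: X_def d_def)
        also have "\<dots> = 2 * lead_coeff P"
          using R(3) by simp
        also have "\<dots> \<noteq> 0"
          using \<open>P \<noteq> 0\<close> by simp
        finally have top: "coeff (X * R + P) d \<noteq> 0" .
        then have nz: "d \<le> degree (X * R + P)" "X * R + P \<noteq> 0"
          by (rule le_degree, metis coeff_0 top)
        have "degree R' + degree (X * R + P) = degree (R ^ 2 - 1)"
          unfolding prod[symmetric] using False nz(2) by (simp add: degree_mult_eq)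
        also have "\<dots> \<le> 2 * (d - 1)"
          using degree_power_le[of R 2] R(2) by (intro degree_diff_le) auto
        finally have "degree R' \<le> d - 2" "d \<ge> 2"
          using nz(1) \<open>d > 0\<close> by linarith+
        have "degree (P' ^ 2) = degree (D * R' ^ 2 + 1)"
          using pell' by (simp add: algebra_simps)
        also have "\<dots> \<le> 2 + 2 * degree R'"
          using degree_mult_le[of D "R' ^ 2"] degree_power_le[of R' 2] D(2)
          by (intro degree_add_le) (auto simp: mult.commute)
        also have "\<dots> \<le> 2 * (d - 1)"
          using \<open>degree R' \<le> d - 2\<close> \<open>d \<ge> 2\<close> by linarith
        finally have "degree (P' ^ 2) \<le> 2 * (d - 1)" .
        then have "degree P' \<le> d - 1"
          by (cases "P' = 0") (auto simp: degree_power_eq)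
        then show ?thesis
          using \<open>d > 0\<close> by simp
      qed
      then obtain k :: int and e where e: "e \<in> {1, -1}" and
          IH: "\<And>t. poly P' (cos t) = e * cos (of_int k * t)" "\<And>t. poly R' (cos t) * sin t = e * sin (of_int k * t)"
        using less.hyps[OF \<open>degree P' < d\<close>[unfolded d_def] pell'[unfolded D_def]] by blast
      have PR: "poly P (cos t) = e * cos (of_int (k + 1) * t) \<and> poly R (cos t) * sin t = e * sin (of_int (k + 1) * t)" for t
      proof
        have "poly D (cos t) = - (sin t ^ 2)"
          unfolding sin_squared_eq by (simp add: D_def power2_eq_square)
        then have "poly P (cos t) = cos t * poly P' (cos t) - sin t * (poly R' (cos t) * sin t)"
          by (subst recover(1)) (simp add: X_def power2_eq_square)
        also have "\<dots> = e * cos (of_int (k + 1) * t)"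
          unfolding IH by (simp add: cos_add algebra_simps)
        finally show "poly P (cos t) = e * cos (of_int (k + 1) * t)" .
        have "poly R (cos t) * sin t = cos t * (poly R' (cos t) * sin t) + sin t * poly P' (cos t)"
          by (subst recover(2)) (simp add: X_def algebra_simps)
        also have "\<dots> = e * sin (of_int (k + 1) * t)"
          unfolding IH by (simp add: sin_add algebra_simps)
        finally show "poly R (cos t) * sin t = e * sin (of_int (k + 1) * t)" .
      qed
      then show ?thesis
        using e by blast
    qed
    show ?thesis
      using lc
    proof
      assume "lead_coeff P = lead_coeff Q"
      then show ?thesis
        using core pell dQ by blast
    next
      assume "lead_coeff P = lead_coeff (- Q)"
      then obtain k :: int and e where e: "e \<in> {1, -1}" and
          sol: "\<And>t. poly P (cos t) = e * cos (of_int k * t) \<and> poly (- Q) (cos t) * sin t = e * sin (of_int k * t)"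
        using core[of "- Q"] pell dQ by (metis degree_minus power2_minus)
      then show ?thesis
      proof (intro exI[of _ "- k"] exI[of _ e] conjI allI)
        fix t :: complex
        show "poly P (cos t) = e * cos (of_int (- k) * t)"
          using sol[of t] by simp
        have "poly Q (cos t) * sin t = - (poly (- Q) (cos t) * sin t)"
          by simp
        also have "\<dots> = e * sin (of_int (- k) * t)"
          using sol[of t] by simp
        finally show "poly Q (cos t) * sin t = e * sin (of_int (- k) * t)" .
      qed (use e in blast)
    qed
  qed
qed

lemma complex_poly_square_if_even_orders:
  fixes p :: "complex poly"
  assumes "\<And>a. even (order a p)"
  obtains q where "p = q ^ 2"
proof
  have "[:- z, 1:] ^ order z p = ([:- z, 1:] ^ (order z p div 2)) ^ 2" for z
    using assms[of z] by (simp flip: power_mult)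
  then have "(\<Prod>z | poly p z = 0. [:- z, 1:] ^ order z p) = (\<Prod>z | poly p z = 0. [:- z, 1:] ^ (order z p div 2)) ^ 2"
    by (simp add: prod_power_distrib)
  then show "p = smult (csqrt (lead_coeff p)) (\<Prod>z | poly p z = 0. [:- z, 1:] ^ (order z p div 2)) ^ 2"
    using complex_poly_decompose[of p] by (simp add: smult_power)
qed

text \<open>The polynomial $P^2 - 1$ has odd order exactly at $1$ and $-1$, so it is $(x^2 - 1)$ times a
polynomial with all orders even, that is, times a square. This is the Pell equation.\<close>

lemma chebyshev_poly_characterization:
  fixes P :: "complex poly"
  assumes "degree P > 0"
    and odd_iff: "\<And>z. poly P z \<in> {1, -1} \<Longrightarrow> odd (order z (P - [:poly P z:])) \<longleftrightarrow> z \<in> {1, -1}"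
    and ends: "poly P 1 \<in> {1, -1}" "poly P (-1) \<in> {1, -1}"
  shows "P = chebyshev_poly (degree P) \<or> P = - chebyshev_poly (degree P)"
proof -
  define D :: "complex poly" where "D = [:-1, 1:] * [:1, 1:]"
  have nz: "P - [:c:] \<noteq> 0" for c
    using assms(1) by auto
  have fact: "P ^ 2 - 1 = (P - [:1:]) * (P - [:-1:])"
    by (simp add: power2_eq_square algebra_simps one_pCons)
  have R0: "P ^ 2 - 1 \<noteq> 0"
    unfolding fact using nz by simp
  have ordR: "odd (order z (P ^ 2 - 1)) \<longleftrightarrow> z \<in> {1, -1}" for z
  proof (cases "poly P z \<in> {1, -1}")
    case True
    have "order z (P ^ 2 - 1) = order z (P - [:1:]) + order z (P - [:-1:])"
      unfolding fact using nz by (subst order_mult) auto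
    moreover have "poly P z = 1 \<Longrightarrow> order z (P - [:-1:]) = 0" "poly P z = -1 \<Longrightarrow> order z (P - [:1:]) = 0"
      by (auto intro!: order_0I)
    ultimately have "order z (P ^ 2 - 1) = order z (P - [:poly P z:])"
      using True by auto
    then show ?thesis
      using odd_iff[OF True] by simp
  next
    case False
    then have "order z (P ^ 2 - 1) = 0"
      by (intro order_0I) (auto simp: poly_power power2_eq_1_iff)
    moreover have "z \<notin> {1, -1}"
      using False ends by auto
    ultimately show ?thesis by simp
  qed
  have "poly (P ^ 2 - 1) 1 = 0" "poly (P ^ 2 - 1) (-1) = 0"
    using ends by (auto simp: poly_power)
  then obtain S1 where S1: "P ^ 2 - 1 = [:-1, 1:] * S1"
    using poly_eq_0_iff_dvd by (metis dvdE)
  then have "poly S1 (-1) = 0"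
    using \<open>poly (P ^ 2 - 1) (-1) = 0\<close> by simp
  then obtain S where "S1 = [:- (-1), 1:] * S"
    using poly_eq_0_iff_dvd by (metis dvdE)
  then have S: "P ^ 2 - 1 = D * S"
    using S1 by (simp add: D_def mult.assoc)
  have "D \<noteq> 0" "S \<noteq> 0"
    using R0 unfolding S by auto
  have ordD: "order z D = (if z \<in> {1, -1} then 1 else 0)" for z
  proof -
    have "order z D = order z [:-1, 1:] + order z [:1, 1:]"
      unfolding D_def by (subst order_mult) auto
    moreover have "order z [:-1, 1:] = (if z = 1 then 1 else 0)"
      using order_power_n_n[of 1 1] by (auto intro!: order_0I)
    moreover have "order z [:1, 1:] = (if z = -1 then 1 else 0)"
      using order_power_n_n[of "-1" 1] by (auto intro!: order_0I simp: add_eq_0_iff)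
    ultimately show ?thesis by auto
  qed
  have "even (order z S)" for z
    using ordR[of z] R0 ordD[of z] unfolding S by (auto simp: order_mult split: if_splits)
  then obtain Q where "S = Q ^ 2"
    by (rule complex_poly_square_if_even_orders)
  then have "P ^ 2 - [:-1, 0, 1:] * Q ^ 2 = 1"
    using S by (simp add: D_def algebra_simps)
  from pell_solutions[OF this]
  obtain k :: int and e where e: "e \<in> {1, -1}" and P: "\<And>t. poly P (cos t) = e * cos (of_int k * t)"
    by blast
  \<comment> \<open>Chebyshev polynomials have natural indices; the cosine is even.\<close>
  define m where "m = nat \<bar>k\<bar>"
  have "cos (of_int k * t) = cos (of_nat m * t)" for t :: complex
    by (cases "k \<ge> 0") (auto simp: m_def)
  then have P_eq: "P = smult e (chebyshev_poly m)"
    by (intro poly_eqI_cos) (simp add: P poly_chebyshev_poly)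
  have "degree P = m"
    unfolding P_eq using e by (auto simp: degree_chebyshev_poly)
  then show ?thesis
    using P_eq e by (elim insertE) simp_all
qed

section \<open>Recognizing Chebyshev polynomials\<close>

text \<open>With representatives $X, Y, Z$ of the three points and $[\cdot,\cdot]$ the determinant, the columns
of the matrix are $[X,Z] Y - [X,Y] Z$ and $[X,Z] Y + [X,Y] Z$. Their sum and difference are
multiples of $Y$ and $Z$, and the first one equals $[Y,Z] X$ by the three-term relation.\<close>

lemma moebius_three_points:
  assumes "x \<noteq> y" "x \<noteq> z" "y \<noteq> z"
  obtains a b c d where "a * d - b * c \<noteq> 0" "moebius a b c d None = x"
    "moebius a b c d (Some 1) = y" "moebius a b c d (Some (-1)) = z"
proof -
  obtain u0 v0 where x: "u0 \<noteq> 0 \<or> v0 \<noteq> 0" "x = pt u0 v0"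
    by (rule pt_exhaust)
  obtain u1 v1 where y: "u1 \<noteq> 0 \<or> v1 \<noteq> 0" "y = pt u1 v1"
    by (rule pt_exhaust)
  obtain u2 v2 where z: "u2 \<noteq> 0 \<or> v2 \<noteq> 0" "z = pt u2 v2"
    by (rule pt_exhaust)
  define s where "s = u0 * v2 - u2 * v0"
  define t where "t = u0 * v1 - u1 * v0"
  define r where "r = u1 * v2 - u2 * v1"
  have nz: "s \<noteq> 0" "t \<noteq> 0" "r \<noteq> 0"
    unfolding s_def t_def r_def
    using assms pt_eq_iff[OF x(1) z(1)] pt_eq_iff[OF x(1) y(1)] pt_eq_iff[OF y(1) z(1)] x y z by auto
  define a where "a = s * u1 - t * u2"
  define b where "b = s * u1 + t * u2"
  define c where "c = s * v1 - t * v2"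
  define d where "d = s * v1 + t * v2"
  have "a * d - b * c = 2 * (s * t * r)"
    unfolding a_def b_def c_def d_def r_def by (simp add: algebra_simps)
  then have det: "a * d - b * c \<noteq> 0"
    using nz by simp
  have ac: "a = r * u0" "c = r * v0"
    unfolding a_def c_def r_def s_def t_def by (simp_all add: algebra_simps)
  have bd: "a + b = 2 * s * u1" "c + d = 2 * s * v1" "b - a = 2 * t * u2" "d - c = 2 * t * v2"
    unfolding a_def b_def c_def d_def by simp_all
  have scale: "pt (k * u) (k * v) = pt u v" if "k \<noteq> 0" for k u v
    using that by (simp add: pt_def)
  have "moebius a b c d None = x"
    using moebius_pt[OF det, of 1 0] nz x(2) by (simp add: pt_def ac)
  moreover have "moebius a b c d (Some 1) = y"
  proof -
    have "moebius a b c d (pt 1 1) = pt (2 * s * u1) (2 * s * v1)"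
      using moebius_pt[OF det, of 1 1] bd(1,2) by simp
    then show ?thesis
      using nz y(2) by (simp add: scale pt_def)
  qed
  moreover have "moebius a b c d (Some (-1)) = z"
  proof -
    have "moebius a b c d (pt (-1) 1) = pt (2 * t * u2) (2 * t * v2)"
      using moebius_pt[OF det, of "-1" 1] bd(3,4) by simp
    then show ?thesis
      using nz z(2) by (simp add: scale pt_def)
  qed
  ultimately show ?thesis
    using that[OF det] by blast
qed

lemma moebius_conjugate_refl: "moebius_conjugate f f"
  by (rule moebius_conjugateI[of 1 1 0 0]) (simp_all add: moebius_scalar)

lemma local_degree_conjugate:
  assumes det: "a * d - b * c \<noteq> 0" and f: "rational_of_degree f n" "n \<ge> 1"
  shows "local_degree (inv (moebius a b c d) \<circ> f \<circ> moebius a b c d) z = local_degree f (moebius a b c d z)"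
proof -
  have det': "d * a - (- b) * (- c) \<noteq> 0"
    using det by (simp add: mult.commute)
  have 1: "rational_of_degree (moebius d (- b) (- c) a \<circ> f) (1 * n)"
    by (rule rational_of_degree_comp[OF rational_of_degree_moebius[OF det'] f(1) le_refl f(2)])
  have "local_degree (moebius d (- b) (- c) a \<circ> f \<circ> moebius a b c d) z =
      local_degree (moebius d (- b) (- c) a \<circ> f) (moebius a b c d z) * local_degree (moebius a b c d) z"
    using f(2) by (intro local_degree_comp[OF 1 _ rational_of_degree_moebius[OF det]]) auto
  also have "local_degree (moebius d (- b) (- c) a \<circ> f) (moebius a b c d z) =
      local_degree (moebius d (- b) (- c) a) (f (moebius a b c d z)) * local_degree f (moebius a b c d z)"
    by (rule local_degree_comp[OF rational_of_degree_moebius[OF det'] le_refl f])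
  finally show ?thesis
    unfolding inv_moebius[OF det] local_degree_moebius[OF det] local_degree_moebius[OF det']
    by (simp only: mult_1 mult_1_right)
qed

text \<open>Moving \<open>c\<close>, \<open>a\<close>, \<open>b\<close> to infinity, $1$, $-1$ turns \<open>f\<close> into a polynomial. Over a point of
ramification $2$, invariance says that the local degree is odd at points of ramification $2$ and even
elsewhere, which is the characterization of the Chebyshev polynomials up to sign.\<close>

lemma ramified_triple_imp_chebyshev:
  assumes f: "rational_of_degree f n" "n \<ge> 1"
    and distinct: "c \<noteq> a" "c \<noteq> b" "a \<noteq> b"
    and supp: "{z. \<nu> z \<noteq> 1} = {c, a, b}" and "\<nu> a = 2" "\<nu> b = 2"
    and inv: "\<And>z. \<nu> (f z) = \<nu> z * gcd (local_degree f z) (\<nu> (f z))"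
    and c: "\<And>z. f z = c \<Longrightarrow> z = c"
  shows "moebius_conjugate f (rat_map (chebyshev_poly n) 1) \<or>
         moebius_conjugate f (rat_map (- chebyshev_poly n) 1)"
proof -
  obtain k l m j where det: "k * j - l * m \<noteq> 0" and
    M0: "moebius k l m j None = c" "moebius k l m j (Some 1) = a" "moebius k l m j (Some (-1)) = b"
    by (rule moebius_three_points[OF distinct])
  define M where "M = moebius k l m j"
  have M: "M None = c" "M (Some 1) = a" "M (Some (-1)) = b"
    unfolding M_def by (fact M0)+
  have bij: "bij M"
    unfolding M_def by (rule bij_moebius[OF det])
  have M_eq: "M x = M y \<longleftrightarrow> x = y" for x y
    by (rule inj_eq[OF bij_is_inj[OF bij]])
  define g where "g = inv M \<circ> f \<circ> M"
  have Mg: "M (g z) = f (M z)" for z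
    using bij by (simp add: g_def bij_is_surj surj_f_inv_f)
  have "rational_of_degree g n"
    unfolding g_def M_def by (rule rational_of_degree_conjugate[OF det f])
  then obtain p q where pq: "coprime p q" "g = rat_map p q" "n = max (degree p) (degree q)"
    unfolding rational_of_degree_def by blast
  have "poly q z \<noteq> 0" for z
  proof
    assume "poly q z = 0"
    then have "g (Some z) = None"
      by (simp add: pq(2) rat_map_def)
    then have "f (M (Some z)) = c"
      using Mg[of "Some z"] M(1) by simp
    then have "M (Some z) = M None"
      using c M(1) by simp
    then show False
      unfolding M_eq by simp
  qed
  then obtain r where r: "q = [:r:]" "r \<noteq> 0"
    by (rule no_roots_imp_const)
  define P where "P = smult (1 / r) p"
  have "rat_map (smult r P) (smult r 1) = rat_map p q"
    using r by (simp add: P_def)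
  then have gP: "g = rat_map P 1"
    unfolding pq(2) rat_map_smult[OF r(2)] ..
  have degP: "degree P = n"
    using pq(3) r by (simp add: P_def)
  interpret rational_map P 1 g n
    using f(2) by unfold_locales (simp_all add: gP degP)
  have g_Some: "g (Some z) = Some (poly P z)" for z
    by (simp add: gP rat_map_def)
  define \<mu> where "\<mu> = \<nu> \<circ> M"
  have \<mu>: "\<mu> (Some 1) = 2" "\<mu> (Some (-1)) = 2"
    using M assms(7,8) by (simp_all add: \<mu>_def)
  have \<mu>1: "\<mu> (Some z) = 1" if "z \<notin> {1, -1}" for z
  proof -
    have "M (Some z) \<noteq> M None" "M (Some z) \<noteq> M (Some 1)" "M (Some z) \<noteq> M (Some (-1))"
      unfolding M_eq using that by auto
    then have "M (Some z) \<notin> {z. \<nu> z \<noteq> 1}"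
      unfolding supp M by simp
    then show ?thesis
      by (simp add: \<mu>_def)
  qed
  have inv\<mu>: "\<mu> (Some (poly P z)) = \<mu> (Some z) * gcd (order z (P - [:poly P z:])) (\<mu> (Some (poly P z)))" for z
  proof -
    have "local_degree f (M (Some z)) = local_degree g (Some z)"
      unfolding g_def M_def by (rule local_degree_conjugate[OF det f, symmetric])
    also have "\<dots> = order z (P - [:poly P z:])"
      unfolding local_degree_Some g_Some by (simp add: pencil_def smult_one)
    finally show ?thesis
      using inv[of "M (Some z)"] by (simp add: \<mu>_def g_Some flip: Mg)
  qed
  have "P = chebyshev_poly (degree P) \<or> P = - chebyshev_poly (degree P)"
  proof (rule chebyshev_poly_characterization)
    show "degree P > 0"
      using degP f(2) by simp
    fix z
    assume "poly P z \<in> {1, -1}"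
    then have "\<mu> (Some (poly P z)) = 2"
      using \<mu> by auto
    then have eq: "2 = \<mu> (Some z) * gcd (order z (P - [:poly P z:])) 2"
      using inv\<mu>[of z] by simp
    show "odd (order z (P - [:poly P z:])) \<longleftrightarrow> z \<in> {1, -1}"
    proof (cases "z \<in> {1, -1}")
      case True
      then have "\<mu> (Some z) = 2"
        using \<mu> by auto
      then have "gcd (order z (P - [:poly P z:])) 2 = 1"
        using eq by simp
      then have "odd (order z (P - [:poly P z:]))"
        by (metis coprime_iff_gcd_eq_1 coprime_right_2_iff_odd)
      then show ?thesis
        using True by simp
    next
      case False
      then have "gcd (order z (P - [:poly P z:])) 2 = 2"
        using eq \<mu>1[OF False] by simp
      then have "even (order z (P - [:poly P z:]))"
        by (metis gcd_dvd1)
      then show ?thesis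
        using False by simp
    qed
  next
    have "poly P z \<in> {1, -1}" if "\<mu> (Some z) = 2" for z
    proof (rule ccontr)
      assume "poly P z \<notin> {1, -1}"
      then show False
        using inv\<mu>[of z] \<mu>1 that by simp
    qed
    then show "poly P 1 \<in> {1, -1}" "poly P (-1) \<in> {1, -1}"
      using \<mu> by blast+
  qed
  then have "moebius_conjugate g (rat_map (chebyshev_poly n) 1) \<or> moebius_conjugate g (rat_map (- chebyshev_poly n) 1)"
    unfolding gP degP using moebius_conjugate_refl by metis
  then show ?thesis
    using moebius_conjugate_trans[OF det, of f] unfolding g_def M_def by blast
qed

section \<open>Invariant ramification functions\<close>

lemma pullback_fixed_eq:
  assumes "pullback f \<nu> = \<nu>"
  shows "\<nu> (f z) = \<nu> z * gcd (local_degree f z) (\<nu> (f z))"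
proof -
  have "\<nu> z = \<nu> (f z) div gcd (local_degree f z) (\<nu> (f z))"
    using fun_cong[OF assms, of z] by (simp add: pullback_def)
  then show ?thesis
    by simp
qed

context rational_map
begin

lemma local_degree_pos: "local_degree f z > 0"
  by (rule local_form_pos[OF local_form_local_degree])

lemma finite_preimage: "finite S \<Longrightarrow> finite {z. f z \<in> S}"
proof -
  assume "finite S"
  then have "finite (\<Union>w\<in>S. {z. f z = w})"
    using finite_fibre by blast
  moreover have "{z. f z \<in> S} = (\<Union>w\<in>S. {z. f z = w})"
    by blast
  ultimately show ?thesis by simp
qed

lemma finite_support_pullback:
  assumes "finite {z. \<nu> z \<noteq> 1}"
  shows "finite {z. pullback f \<nu> z \<noteq> 1}"
  by (rule finite_subset[OF _ finite_preimage[OF assms]]) (auto simp: pullback_def)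

text \<open>This says that the orbifold Euler characteristic is nonnegative. Let $E$ be the sum. Minimality
gives $\nu(f(z)) \le \nu(z) \deg_z f$; summing $1 - 1/\nu(z)$ over all preimages of the support and
using that each fibre has $n$ points with multiplicity yields $E \ge nE - \sum (\deg_z f - 1)$, and
the Riemann-Hurwitz inequality bounds the last sum by $2n - 2$.\<close>

lemma invariant_ramification_sum_le:
  assumes "n \<ge> 2" and pos: "\<And>z. 0 < \<nu> z" and fin: "finite {z. \<nu> z \<noteq> 1}" and inv: "pullback f \<nu> = \<nu>"
  shows "(\<Sum>z | \<nu> z \<noteq> 1. 1 - 1 / real (\<nu> z)) \<le> 2"
proof -
  define S where "S = {z. \<nu> z \<noteq> 1}"
  define F where "F = {z. f z \<in> S}"
  define E where "E = (\<Sum>z\<in>S. 1 - 1 / real (\<nu> z))"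
  have "finite S"
    using fin by (simp add: S_def)
  then have "finite F"
    unfolding F_def by (rule finite_preimage)
  have "z \<in> F" if "z \<in> S" for z
    using that pullback_fixed_eq[OF inv, of z] by (auto simp: F_def S_def)
  \<comment> \<open>The support lies in its own preimage: a point over an unramified point is unramified.\<close>
  then have "E = (\<Sum>z\<in>F. 1 - 1 / real (\<nu> z))"
    unfolding E_def using \<open>finite F\<close> by (intro sum.mono_neutral_left) (auto simp: S_def)
  also have "\<dots> \<ge> (\<Sum>z\<in>F. 1 - real (local_degree f z) / real (\<nu> (f z)))"
  proof (intro sum_mono diff_left_mono)
    fix z
    have "\<nu> (f z) \<le> \<nu> z * local_degree f z"
      using pullback_fixed_eq[OF inv, of z] gcd_le1_nat[of "local_degree f z" "\<nu> (f z)"] local_degree_pos[of z]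
      by (metis mult_le_mono2 not_less_zero)
    then have "real (\<nu> (f z)) \<le> real (\<nu> z) * real (local_degree f z)"
      by (simp flip: of_nat_mult)
    then show "1 / real (\<nu> z) \<le> real (local_degree f z) / real (\<nu> (f z))"
      using pos[of z] pos[of "f z"] by (simp add: field_simps)
  qed
  also have "(\<Sum>z\<in>F. 1 - real (local_degree f z) / real (\<nu> (f z))) =
      (\<Sum>z\<in>F. real (local_degree f z) * (1 - 1 / real (\<nu> (f z)))) - (\<Sum>z\<in>F. real (local_degree f z - 1))"
    using local_degree_pos by (simp add: of_nat_diff Suc_le_eq algebra_simps flip: sum_subtractf)
  also have "(\<Sum>z\<in>F. real (local_degree f z) * (1 - 1 / real (\<nu> (f z)))) = real n * E"
  proof -
    have "(\<Sum>z\<in>F. real (local_degree f z) * (1 - 1 / real (\<nu> (f z)))) =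
        (\<Sum>w\<in>S. \<Sum>z\<in>{z \<in> F. f z = w}. real (local_degree f z) * (1 - 1 / real (\<nu> (f z))))"
      by (rule sum.group[symmetric]) (use \<open>finite F\<close> \<open>finite S\<close> in \<open>auto simp: F_def\<close>)
    also have "\<dots> = (\<Sum>w\<in>S. real n * (1 - 1 / real (\<nu> w)))"
    proof (intro sum.cong refl)
      fix w assume "w \<in> S"
      then have "{z \<in> F. f z = w} = {z. f z = w}"
        by (auto simp: F_def)
      then have "(\<Sum>z\<in>{z \<in> F. f z = w}. real (local_degree f z) * (1 - 1 / real (\<nu> (f z)))) =
          (\<Sum>z | f z = w. real (local_degree f z) * (1 - 1 / real (\<nu> w)))"
        by (auto intro!: sum.cong)
      also have "\<dots> = real (\<Sum>z | f z = w. local_degree f z) * (1 - 1 / real (\<nu> w))"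
        by (simp add: sum_distrib_right)
      finally show "(\<Sum>z\<in>{z \<in> F. f z = w}. real (local_degree f z) * (1 - 1 / real (\<nu> (f z)))) =
          real n * (1 - 1 / real (\<nu> w))"
        unfolding sum_local_degree_fibre .
    qed
    finally show ?thesis
      by (simp add: E_def sum_distrib_left)
  qed
  finally have "real n * E - (\<Sum>z\<in>F. real (local_degree f z - 1)) \<le> E" .
  moreover have "(\<Sum>z\<in>F. real (local_degree f z - 1)) \<le> 2 * real n - 2"
  proof -
    have "real (\<Sum>z\<in>F. local_degree f z - 1) \<le> real (2 * n - 2)"
      using riemann_hurwitz_le[OF \<open>finite F\<close>] by (simp only: of_nat_le_iff)
    then show ?thesis
      using n_pos by (simp add: of_nat_diff)
  qed
  ultimately have "(real n - 1) * E \<le> (real n - 1) * 2"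
    by (simp add: algebra_simps)
  then have "E \<le> 2"
    using \<open>n \<ge> 2\<close> by (subst (asm) mult_le_cancel_left_pos) auto
  then show ?thesis
    unfolding E_def S_def .
qed

end

lemma half_le_ramification_term:
  assumes "0 < k" "k \<noteq> 1"
  shows "1 / 2 \<le> 1 - 1 / real k"
  using assms by (simp add: field_simps)

lemma card_support_le:
  assumes "\<And>z. 0 < \<nu> z" "(\<Sum>z | \<nu> z \<noteq> 1. 1 - 1 / real (\<nu> z)) \<le> 2"
  shows "card {z. \<nu> z \<noteq> 1} \<le> 4"
proof -
  have "(\<Sum>z | \<nu> z \<noteq> 1. 1 / 2 :: real) \<le> (\<Sum>z | \<nu> z \<noteq> 1. 1 - 1 / real (\<nu> z))"
    by (rule sum_mono) (use assms(1) half_le_ramification_term in blast)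
  then show ?thesis
    using assms(2) by simp
qed

text \<open>The points other than \<open>c\<close> contribute together less than $7/6$. Each contributes at least $1/2$, so there are
at most two of them; two of them both have the value $2$, since $2/3 + 1/2 = 7/6$.\<close>

lemma large_ramification_cases:
  assumes orb: "orbifold \<nu>" and sum: "(\<Sum>z | \<nu> z \<noteq> 1. 1 - 1 / real (\<nu> z)) \<le> 2" and c: "\<nu> c > 6"
  obtains a where "a \<noteq> c" "{z. \<nu> z \<noteq> 1} = {c, a}" "\<nu> a = \<nu> c"
  | a b where "c \<noteq> a" "c \<noteq> b" "a \<noteq> b" "{z. \<nu> z \<noteq> 1} = {c, a, b}" "\<nu> a = 2" "\<nu> b = 2"
proof -
  have pos: "0 < \<nu> z" for z
    using orb unfolding orbifold_def by (metis less_le_trans zero_less_one)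
  have fin: "finite {z. \<nu> z \<noteq> 1}"
    using orb unfolding orbifold_def by blast
  define S where "S = {z. \<nu> z \<noteq> 1} - {c}"
  have supp: "{z. \<nu> z \<noteq> 1} = insert c S" and "c \<notin> S" and "finite S"
    using c fin by (auto simp: S_def)
  have half: "1 / 2 \<le> 1 - 1 / real (\<nu> z)" if "z \<in> S" for z
    using that pos by (intro half_le_ramification_term) (auto simp: S_def)
  have "(1 - 1 / real (\<nu> c)) + (\<Sum>z\<in>S. 1 - 1 / real (\<nu> z)) \<le> 2"
    using sum \<open>c \<notin> S\<close> \<open>finite S\<close> unfolding supp by simp
  moreover have "1 / real (\<nu> c) < 1 / 6"
    using c by (simp add: field_simps)
  ultimately have sumS: "(\<Sum>z\<in>S. 1 - 1 / real (\<nu> z)) < 7 / 6"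
    by linarith
  have "(\<Sum>z\<in>S. 1 / 2 :: real) \<le> (\<Sum>z\<in>S. 1 - 1 / real (\<nu> z))"
    by (rule sum_mono) (rule half)
  then have "card S \<le> 2"
    using sumS by simp
  then consider "card S = 0" | "card S = 1" | "card S = 2"
    by linarith
  then show ?thesis
  proof cases
    case 1
    then have "{z. \<nu> z \<noteq> 1} = {c}"
      using supp \<open>finite S\<close> by simp
    then show ?thesis
      using orb unfolding orbifold_def by blast
  next
    case 2
    then obtain a where a: "S = {a}"
      by (rule card_1_singletonE)
    then have "a \<noteq> c" "{z. \<nu> z \<noteq> 1} = {c, a}"
      using supp \<open>c \<notin> S\<close> by auto
    moreover from this have "\<nu> a = \<nu> c"
      using orb unfolding orbifold_def by metis
    ultimately show ?thesis
      by (rule that(1))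
  next
    case 3
    then obtain a b where ab: "S = {a, b}" "a \<noteq> b"
      by (auto simp: card_2_iff)
    have lt: "(1 - 1 / real (\<nu> a)) + (1 - 1 / real (\<nu> b)) < 7 / 6"
      using sumS ab by simp
    have two: "\<nu> x = 2" if "x \<in> S" "1 - 1 / real (\<nu> x) < 2 / 3" for x
    proof (rule ccontr)
      assume "\<nu> x \<noteq> 2"
      moreover have "\<nu> x \<noteq> 1" "0 < \<nu> x"
        using that(1) pos by (auto simp: S_def)
      ultimately have "\<nu> x \<ge> 3"
        by linarith
      then have "1 / real (\<nu> x) \<le> 1 / 3"
        by (simp add: field_simps)
      then show False
        using that(2) by linarith
    qed
    have "\<nu> a = 2" "\<nu> b = 2"
      using two[of a] two[of b] half[of a] half[of b] lt ab(1) by auto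
    moreover have "c \<noteq> a" "c \<noteq> b"
      using \<open>c \<notin> S\<close> ab by auto
    ultimately show ?thesis
      using that(2)[of a b] ab supp by simp
  qed
qed

text \<open>If $\nu(c) > 2n$, a point $z$ with $\nu(f(z)) = \nu(c)$ has $\nu(z) > 2$, because local degrees are at
most $n$. For the signature $(N, N)$ this makes the support fully invariant, and \<open>f\<close> is conjugate to a
power map; for $(2, 2, N)$ it makes \<open>c\<close> fully invariant, and \<open>f\<close> is conjugate to a Chebyshev
polynomial up to sign.\<close>

lemma invariant_orbifold_bounded:
  assumes f: "rational_of_degree f n" "n \<ge> 2"
    and not_special: "\<not> moebius_conjugate f (rat_map (monom 1 n) 1)"
      "\<not> moebius_conjugate f (rat_map 1 (monom 1 n))"
      "\<not> moebius_conjugate f (rat_map (chebyshev_poly n) 1)"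
      "\<not> moebius_conjugate f (rat_map (- chebyshev_poly n) 1)"
    and \<nu>: "orbifold \<nu>" "pullback f \<nu> = \<nu>"
  shows "\<nu> c \<le> 6 + 2 * n" and "card {z. \<nu> z \<noteq> 1} \<le> 4"
proof -
  have "n \<ge> 1"
    using f(2) by simp
  obtain p q where "rational_map p q f n"
    by (rule rational_of_degree_obtain[OF f(1) \<open>n \<ge> 1\<close>])
  then interpret rational_map p q f n .
  have pos: "0 < \<nu> z" for z
    using \<nu>(1) unfolding orbifold_def by (metis less_le_trans zero_less_one)
  have fin: "finite {z. \<nu> z \<noteq> 1}"
    using \<nu>(1) unfolding orbifold_def by blast
  note inv = pullback_fixed_eq[OF \<nu>(2)]
  have sum: "(\<Sum>z | \<nu> z \<noteq> 1. 1 - 1 / real (\<nu> z)) \<le> 2"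
    by (rule invariant_ramification_sum_le[OF f(2) pos fin \<nu>(2)])
  show "card {z. \<nu> z \<noteq> 1} \<le> 4"
    by (rule card_support_le[OF pos sum])
  show "\<nu> c \<le> 6 + 2 * n"
  proof (rule ccontr)
    assume "\<not> \<nu> c \<le> 6 + 2 * n"
    then have c: "\<nu> c > 6" "\<nu> c > 2 * n"
      by auto
    have big: "\<nu> z > 2" if "\<nu> (f z) = \<nu> c" for z
    proof (rule ccontr)
      assume "\<not> \<nu> z > 2"
      have "gcd (local_degree f z) (\<nu> (f z)) \<le> n"
        using gcd_le1_nat[of "local_degree f z" "\<nu> (f z)"] local_degree_pos[of z] local_degree_le[of z] by linarith
      then have "\<nu> z * gcd (local_degree f z) (\<nu> (f z)) \<le> 2 * n"
        using \<open>\<not> \<nu> z > 2\<close> by (intro mult_le_mono) auto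
      then show False
        using inv[of z] c(2) that by linarith
    qed
    show False
      using \<nu>(1) sum c(1)
    proof (cases rule: large_ramification_cases)
      case (1 a)
      have "z \<in> {a, c}" if "f z \<in> {a, c}" for z
      proof -
        have "\<nu> (f z) = \<nu> c"
          using that 1(3) by auto
        then have "z \<in> {z. \<nu> z \<noteq> 1}"
          using big[of z] by auto
        then show ?thesis
          unfolding 1(2) by blast
      qed
      then show False
        using fully_invariant_pair_imp_power_map[OF f 1(1)] not_special(1,2) by blast
    next
      case (2 a b)
      have "z = c" if "f z = c" for z
      proof -
        have "\<nu> z > 2"
          using big that by simp
        then have "z \<in> {z. \<nu> z \<noteq> 1}" "z \<noteq> a" "z \<noteq> b"
          using 2(5,6) by auto
        then show ?thesis
          unfolding 2(4) by blast
      qed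
      then show False
        using ramified_triple_imp_chebyshev[OF f(1) \<open>n \<ge> 1\<close> 2 inv] not_special(3,4) by blast
    qed
  qed
qed

section \<open>The maximal orbifold\<close>

text \<open>Among the invariant orbifolds one of maximal total ramification exists by the bounds. Its least
common multiple with any other is again invariant and at least as large at every point, hence equal to
it.\<close>

lemma greatest_invariant_orbifold:
  assumes bound: "\<And>\<nu> z. orbifold \<nu> \<Longrightarrow> pullback f \<nu> = \<nu> \<Longrightarrow> \<nu> z \<le> N"
    and card: "\<And>\<nu>. orbifold \<nu> \<Longrightarrow> pullback f \<nu> = \<nu> \<Longrightarrow> card {z. \<nu> z \<noteq> 1} \<le> m"
  shows "\<exists>\<nu>0. orbifold \<nu>0 \<and> pullback f \<nu>0 = \<nu>0 \<and>
    (\<forall>\<nu>. orbifold \<nu> \<and> pullback f \<nu> = \<nu> \<longrightarrow> \<nu> \<preceq> \<nu>0)"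
proof -
  define J where "J \<nu> \<longleftrightarrow> orbifold \<nu> \<and> pullback f \<nu> = \<nu>" for \<nu>
  define size where "size \<nu> = (\<Sum>z | \<nu> z \<noteq> 1. \<nu> z)" for \<nu> :: "cp1 \<Rightarrow> nat"
  have J_pos: "0 < \<nu> z" if "J \<nu>" for \<nu> z
    using that unfolding J_def orbifold_def by (metis less_le_trans zero_less_one)
  have J_fin: "finite {z. \<nu> z \<noteq> 1}" if "J \<nu>" for \<nu>
    using that unfolding J_def orbifold_def by blast
  have "J (\<lambda>_. 1)"
    by (auto simp: J_def orbifold_def pullback_def fun_eq_iff)
  moreover have "\<forall>\<nu>. J \<nu> \<longrightarrow> size \<nu> < m * N + 1"
  proof (intro allI impI)
    fix \<nu> assume "J \<nu>"
    have "size \<nu> \<le> card {z. \<nu> z \<noteq> 1} * N"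
      unfolding size_def using bound \<open>J \<nu>\<close> sum_bounded_above[of "{z. \<nu> z \<noteq> 1}" \<nu> N] by (simp add: J_def)
    also have "\<dots> \<le> m * N"
      using card \<open>J \<nu>\<close> by (simp add: J_def)
    finally show "size \<nu> < m * N + 1" by simp
  qed
  ultimately obtain \<nu>0 where \<nu>0: "J \<nu>0" "\<And>\<nu>. J \<nu> \<Longrightarrow> size \<nu> \<le> size \<nu>0"
    using Lattices_Big.ex_has_greatest_nat[of J "\<lambda>_. 1" size "m * N + 1"] by blast
  have "\<nu> \<preceq> \<nu>0" if "J \<nu>" for \<nu>
  proof -
    define L where "L = orbifold_lcm {\<nu>, \<nu>0}"
    have mem_pos: "0 < \<mu> z" if "\<mu> \<in> {\<nu>, \<nu>0}" for \<mu> z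
      using that \<open>J \<nu>\<close> \<nu>0(1) J_pos by auto
    have "orbifold L"
      unfolding L_def
    proof (rule orbifold_lcm_good)
      fix \<mu> assume "\<mu> \<in> {\<nu>, \<nu>0}"
      then have "J \<mu>"
        using \<open>J \<nu>\<close> \<nu>0(1) by auto
      then show "finite {z. \<mu> z \<noteq> 1}"
        by (rule J_fin)
      show "\<exists>\<mu>'\<in>{\<nu>, \<nu>0}. orbifold \<mu>' \<and> (\<forall>z. \<exists>w. \<mu> z dvd \<mu>' w)"
      proof (intro bexI[OF _ \<open>\<mu> \<in> {\<nu>, \<nu>0}\<close>] conjI allI)
        show "orbifold \<mu>"
          using \<open>J \<mu>\<close> by (simp add: J_def)
        show "\<exists>w. \<mu> z dvd \<mu> w" for z
          by (rule exI[of _ z]) simp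
      qed
    qed (use mem_pos in auto)
    moreover have "pullback f L = L"
    proof -
      have "pullback f L = orbifold_lcm (pullback f ` {\<nu>, \<nu>0})"
        unfolding L_def by (rule pullback_orbifold_lcm) (use mem_pos in auto)
      also have "pullback f ` {\<nu>, \<nu>0} = {\<nu>, \<nu>0}"
        using \<open>J \<nu>\<close> \<nu>0(1) by (simp add: J_def)
      finally show ?thesis
        by (simp add: L_def)
    qed
    ultimately have "J L"
      by (simp add: J_def)
    have "\<nu>0 z \<le> L z" for z
      using orbifold_le_lcm[of \<nu>0 "{\<nu>, \<nu>0}"] J_pos[OF \<open>J L\<close>] unfolding L_def orbifold_le_def
      by (simp add: dvd_imp_le)
    have "L = \<nu>0"
    proof (rule ccontr)
      assume "L \<noteq> \<nu>0"
      then obtain z where "L z \<noteq> \<nu>0 z"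
        by (auto simp: fun_eq_iff)
      then have z: "\<nu>0 z < L z"
        using \<open>\<nu>0 z \<le> L z\<close> by simp
      have zL: "z \<in> {z. L z \<noteq> 1}"
        using z J_pos[OF \<nu>0(1), of z] by simp
      have "size \<nu>0 \<le> (\<Sum>z | L z \<noteq> 1. \<nu>0 z)"
        unfolding size_def
      proof (rule sum_mono2[OF J_fin[OF \<open>J L\<close>]])
        show "{z. \<nu>0 z \<noteq> 1} \<subseteq> {z. L z \<noteq> 1}"
        proof
          fix x assume "x \<in> {z. \<nu>0 z \<noteq> 1}"
          then show "x \<in> {z. L z \<noteq> 1}"
            using \<open>\<And>z. \<nu>0 z \<le> L z\<close>[of x] J_pos[OF \<nu>0(1), of x] by simp
        qed
      qed simp
      also have "\<dots> < size L"
        unfolding size_def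
        by (rule sum_strict_mono_ex1[OF J_fin[OF \<open>J L\<close>]]) (use \<open>\<And>z. \<nu>0 z \<le> L z\<close> z zL in blast)+
      finally show False
        using \<nu>0(2)[OF \<open>J L\<close>] by simp
    qed
    then show ?thesis
      using orbifold_le_lcm[of \<nu> "{\<nu>, \<nu>0}"] unfolding L_def by simp
  qed
  then show ?thesis
    using \<nu>0(1) unfolding J_def by blast
qed

lemma rational_of_degree_funpow:
  assumes "rational_of_degree f n" "n \<ge> 1"
  shows "rational_of_degree (f ^^ l) (n ^ l)"
proof (induction l)
  case 0
  show ?case
    using rational_of_degree_moebius[of 1 1 0 0] moebius_scalar[of 1] by (simp add: id_def)
next
  case (Suc l)
  then show ?case
    using rational_of_degree_comp[OF assms(1) Suc assms(2)] assms(2)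
    by (simp only: funpow.simps power_Suc one_le_power)
qed

lemma pullback_funpow:
  assumes f: "rational_of_degree f n" "n \<ge> 1" and "\<And>z. 0 < \<nu> z"
  shows "pullback (f ^^ l) \<nu> = (pullback f ^^ l) \<nu>"
  using assms(3)
proof (induction l arbitrary: \<nu>)
  case 0
  then show ?case
    using local_degree_id by (simp add: pullback_def fun_eq_iff id_def)
next
  case (Suc l)
  have "pullback (f ^^ Suc l) \<nu> = pullback (f ^^ l) (pullback f \<nu>)"
    unfolding funpow.simps
    by (rule pullback_comp[OF Suc.prems local_degree_comp[OF f rational_of_degree_funpow[OF f]]])
      (use f(2) in simp)
  also have "\<dots> = (pullback f ^^ l) (pullback f \<nu>)"
    using Suc by (simp add: pullback_pos)
  also have "\<dots> = (pullback f ^^ Suc l) \<nu>"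
    by (simp add: funpow_swap1)
  finally show ?case .
qed

text \<open>An orbifold invariant under the iterate lies below one invariant under the map itself, namely the
least common multiple of its successive pullbacks. Since the values of a pullback divide the values
of the original, goodness is inherited.\<close>

lemma periodic_le_invariant_orbifold:
  assumes f: "rational_of_degree f n" "n \<ge> 1" and "l \<ge> 1"
    and \<nu>: "orbifold \<nu>" "(pullback f ^^ l) \<nu> = \<nu>"
  obtains \<mu> where "orbifold \<mu>" "pullback f \<mu> = \<mu>" "\<nu> \<preceq> \<mu>"
proof -
  obtain p q where "rational_map p q f n"
    by (rule rational_of_degree_obtain[OF f])
  then interpret rational_map p q f n .
  define N where "N = (\<lambda>i. (pullback f ^^ i) \<nu>) ` {..<l}"
  have pos: "0 < \<nu> z" for z
    using \<nu>(1) unfolding orbifold_def by (metis less_le_trans zero_less_one)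
  have iter_pos: "0 < (pullback f ^^ i) \<nu> z" for i z
    by (induction i arbitrary: z) (simp_all add: pos pullback_pos)
  have iter_fin: "finite {z. (pullback f ^^ i) \<nu> z \<noteq> 1}" for i
  proof (induction i)
    case 0
    then show ?case using \<nu>(1) unfolding orbifold_def by simp
  next
    case (Suc i)
    then show ?case using finite_support_pullback by simp
  qed
  have iter_dvd: "\<exists>w. (pullback f ^^ i) \<nu> z dvd \<nu> w" for i z
  proof (induction i arbitrary: z)
    case 0
    show ?case by (auto intro: exI[of _ z])
  next
    case (Suc i)
    have "(pullback f ^^ Suc i) \<nu> z dvd (pullback f ^^ i) \<nu> (f z)"
      by (simp add: pullback_dvd)
    then show ?case
      using Suc[of "f z"] dvd_trans by blast
  qed
  have "\<nu> \<in> N"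
    unfolding N_def using \<open>l \<ge> 1\<close> by (intro image_eqI[of _ _ 0]) auto
  have "orbifold (orbifold_lcm N)"
  proof (rule orbifold_lcm_good)
    fix \<mu> assume "\<mu> \<in> N"
    then obtain i where i: "\<mu> = (pullback f ^^ i) \<nu>"
      unfolding N_def by blast
    show "0 < \<mu> z" for z
      unfolding i by (rule iter_pos)
    show "finite {z. \<mu> z \<noteq> 1}"
      unfolding i by (rule iter_fin)
    show "\<exists>\<mu>'\<in>N. orbifold \<mu>' \<and> (\<forall>z. \<exists>w. \<mu> z dvd \<mu>' w)"
      using \<open>\<nu> \<in> N\<close> \<nu>(1) iter_dvd unfolding i by blast
  qed (simp add: N_def)
  moreover have "pullback f (orbifold_lcm N) = orbifold_lcm N"
    unfolding N_def by (rule orbit_lcm_invariant[OF pos \<open>l \<ge> 1\<close> \<nu>(2)])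
  ultimately show ?thesis
    using that orbifold_le_lcm[OF \<open>\<nu> \<in> N\<close>] by blast
qed

theorem theorem1p2:
  fixes A :: "cp1 \<Rightarrow> cp1" and d :: nat
  assumes "d \<ge> 2"
    and "rational_of_degree A d"
    and "\<not> moebius_conjugate A (rat_map (monom 1 d) 1)"
    and "\<not> moebius_conjugate A (rat_map 1 (monom 1 d))"
    and "\<not> moebius_conjugate A (rat_map (chebyshev_poly d) 1)"
    and "\<not> moebius_conjugate A (rat_map (- chebyshev_poly d) 1)"
  shows "\<exists>\<nu>0. is_maximal_orbifold A \<nu>0 \<and>
           (\<forall>l\<ge>1. is_maximal_orbifold (A ^^ l) \<nu>0)"
proof -
  have d1: "d \<ge> 1"
    using assms(1) by simp
  note bounded = invariant_orbifold_bounded[OF assms(2,1,3-6)]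
  obtain \<nu>0 where \<nu>0: "orbifold \<nu>0" "pullback A \<nu>0 = \<nu>0"
    and greatest: "\<And>\<nu>. orbifold \<nu> \<Longrightarrow> pullback A \<nu> = \<nu> \<Longrightarrow> \<nu> \<preceq> \<nu>0"
    using greatest_invariant_orbifold[of A "6 + 2 * d" 4] bounded by blast
  have max: "is_maximal_orbifold (A ^^ l) \<nu>0" if "l \<ge> 1" for l
  proof -
    have rat: "\<exists>e\<ge>1. rational_of_degree (A ^^ l) e"
      using rational_of_degree_funpow[OF assms(2) d1, of l] d1 by (metis one_le_power)
    have pull: "pullback (A ^^ l) \<nu> = (pullback A ^^ l) \<nu>" if "orbifold \<nu>" for \<nu>
      by (rule pullback_funpow[OF assms(2) d1])
        (use that in \<open>simp add: orbifold_def Suc_le_eq\<close>)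
    have "(pullback A ^^ l) \<nu>0 = \<nu>0"
      by (induction l) (simp_all add: \<nu>0(2))
    then have "minimal_holomorphic_map (A ^^ l) \<nu>0 \<nu>0"
      unfolding minimal_holomorphic_map_iff_pullback using rat \<nu>0(1) pull by simp
    moreover have "\<nu> \<preceq> \<nu>0" if orb: "orbifold \<nu>" and min: "minimal_holomorphic_map (A ^^ l) \<nu> \<nu>" for \<nu>
    proof -
      have "(pullback A ^^ l) \<nu> = \<nu>"
        using min pull[OF orb] unfolding minimal_holomorphic_map_iff_pullback by metis
      then obtain \<mu> where "orbifold \<mu>" "pullback A \<mu> = \<mu>" "\<nu> \<preceq> \<mu>"
        by (rule periodic_le_invariant_orbifold[OF assms(2) d1 \<open>l \<ge> 1\<close> orb])
      then show ?thesis
        using greatest[of \<mu>] unfolding orbifold_le_def by (meson dvd_trans)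
    qed
    ultimately show ?thesis
      unfolding is_maximal_orbifold_def using \<nu>0(1) by blast
  qed
  then have "is_maximal_orbifold A \<nu>0"
    using max[of 1] by simp
  then show ?thesis
    using max by blast
qed

end
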